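(* Let $(S_i,v_i)$, $i=1,2$, be immersed submanifolds $S_i\subset\mathbb{R}^{n+1}$ equipped with unit tangent vector fields $v_i\in\Gamma(TS_i)$ such that: $\Phi_{v_1}(S_1)=\Phi_{v_2}(S_2)$; $\Phi_{v_i}:S_i\to\Phi_{v_i}(S_i)$ is a diffeomorphism for $i=1,2$; and $\Phi_{v_i}(S_i)$ is isotropic. Let $\mu_{12}:S_1\to\mathbb{R}$ be the signed distance function $$\mu_{12}(p)=\big\langle p-(\Phi_{v_2}^{-1}\circ\Phi_{v_1})(p),\,v_1(p)\big\rangle,$$ and let $V_2:=\mathrm{d}(\Phi_{v_1}^{-1}\circ\Phi_{v_2})(v_2)\in\Gamma(TS_1)$. Suppose $\mu_{12}$ is nowhere $0$. Then the sectional curvature $K$ of $S_1$ satisfies $$K(V_2,v_1)=\frac{\mathrm{d}\mu_{12}(v_1)-1}{\mu_{12}^2}.$$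
   Context: "Smooth" means $C^2$; the submanifolds $S_i$ are $C^2$-smooth. $\langle\cdot,\cdot\rangle$ is the Euclidean inner product on $\mathbb{R}^{n+1}$. A subset $\mathcal N$ of a manifold $\mathcal M$ is immersed if $\mathcal N$ itself is a smooth manifold and the inclusion is a smooth immersion. $S_1$ carries the induced metric, and $K(A,B)$ is the sectional curvature of the plane spanned by $A,B$. Identify $T\mathbb{S}^n=\{(\xi,\eta)\in\mathbb{R}^{n+1}\times\mathbb{R}^{n+1}: |\xi|=1,\ \langle\xi,\eta\rangle=0\}$, where $(\xi,\eta)$ corresponds to the oriented line $\{\eta+t\xi\}$. For a unit vector field $v$ on $S$, $\Phi_v:S\to T\mathbb{S}^n$ is $\Phi_v(p)=(v(p),p-\langle v(p),p\rangle v(p))$. Let $g$ be the round metric on $\mathbb{S}^n$ and $\pi:T\mathbb{S}^n\to\mathbb{S}^n$ the projection; $\theta_{(\xi,\eta)}(X)=g_\xi(\mathrm{d}\pi(X),\eta)$ and $\Omega=-\mathrm{d}\theta$. A submanifold $\Gamma\subseteq T\mathbb{S}^n$ is isotropic if $\Omega|_\Gamma=0$. *)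

theory Defs
  imports "HOL-Analysis.Analysis"
begin

section \<open>Maps of class C2 on open sets\<close>

definition C2_on :: "'m::euclidean_space set \<Rightarrow> ('m \<Rightarrow> 'b::euclidean_space) \<Rightarrow> bool" where
  "C2_on U f \<longleftrightarrow>
     (\<exists>(f' :: 'm \<Rightarrow> 'm \<Rightarrow>\<^sub>L 'b) (f'' :: 'm \<Rightarrow> 'm \<Rightarrow>\<^sub>L 'm \<Rightarrow>\<^sub>L 'b).
        (\<forall>x\<in>U. (f has_derivative blinfun_apply (f' x)) (at x) \<and>
               (f' has_derivative blinfun_apply (f'' x)) (at x)) \<and>
        continuous_on U f'')"

section \<open>Immersed submanifolds\<close>

text \<open>A manifold structure on a subset \<open>S\<close> of a Euclidean space is given by a family of injective
  local parametrisations \<open>(U, \<phi>)\<close>, \<open>\<phi> : U \<rightarrow> S\<close>, from open subsets of a model space \<open>'m\<close>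
  (so the dimension of the manifold is \<open>DIM('m)\<close>).  The manifold topology is the one making every
  \<open>\<phi> ` U\<close> open and every \<open>\<phi>\<close> a homeomorphism onto its image; it may be finer than the subspace
  topology.  Only the values of \<open>\<phi>\<close> on \<open>U\<close> matter.\<close>

type_synonym ('m, 'a) atlas = "('m set \<times> ('m \<Rightarrow> 'a)) set"

text \<open>A map \<open>f\<close> is C2 between manifolds if the sets below, on which its local expressions
  \<open>\<psi>\<^sup>-\<^sup>1 \<circ> f \<circ> \<phi>\<close> are defined, are open (that is, \<open>f\<close> is continuous) and the local expressions
  are C2.\<close>

definition C2_map :: "('m::euclidean_space, 'a) atlas \<Rightarrow> ('k::euclidean_space, 'b) atlas
    \<Rightarrow> ('a \<Rightarrow> 'b) \<Rightarrow> bool" where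
  "C2_map A B f \<longleftrightarrow>
     (\<forall>(U, \<phi>)\<in>A. \<forall>(W, \<psi>)\<in>B.
        open {u\<in>U. f (\<phi> u) \<in> \<psi> ` W} \<and>
        C2_on {u\<in>U. f (\<phi> u) \<in> \<psi> ` W} (\<lambda>u. inv_into W \<psi> (f (\<phi> u))))"

text \<open>The last conjunct is second countability; the Hausdorff property is automatic because the
  inclusion into the ambient space is injective and continuous.\<close>

definition immersed_submanifold :: "'a::euclidean_space set \<Rightarrow> ('m::euclidean_space, 'a) atlas \<Rightarrow> bool"
  where
  "immersed_submanifold S A \<longleftrightarrow>
     S = (\<Union>(U, \<phi>)\<in>A. \<phi> ` U) \<and>
     (\<forall>(U, \<phi>)\<in>A. open U \<and> inj_on \<phi> U \<and> C2_on U \<phi> \<and>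
                  (\<forall>u\<in>U. inj (frechet_derivative \<phi> (at u)))) \<and>
     C2_map A A id \<and>
     (\<exists>B\<subseteq>A. countable B \<and> S = (\<Union>(U, \<phi>)\<in>B. \<phi> ` U))"

definition diffeomorphism :: "'a set \<Rightarrow> ('m::euclidean_space, 'a) atlas
    \<Rightarrow> 'b set \<Rightarrow> ('k::euclidean_space, 'b) atlas \<Rightarrow> ('a \<Rightarrow> 'b) \<Rightarrow> bool" where
  "diffeomorphism S A T B f \<longleftrightarrow>
     bij_betw f S T \<and> C2_map A B f \<and> C2_map B A (inv_into S f)"

definition tangent_space :: "('m::euclidean_space, 'a::euclidean_space) atlas \<Rightarrow> 'a \<Rightarrow> 'a set" where
  "tangent_space A p =
     {frechet_derivative \<phi> (at u) w | U \<phi> u w. (U, \<phi>) \<in> A \<and> u \<in> U \<and> \<phi> u = p}"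

text \<open>\<open>mdiff A f p X\<close> is the differential of \<open>f\<close> at \<open>p\<close> applied to the tangent vector \<open>X\<close>, for a
  map \<open>f\<close> on the manifold with values in a Euclidean space (or in a submanifold of one).  By the
  chain rule it does not depend on the parametrisation if \<open>f\<close> is differentiable.\<close>

definition mdiff :: "('m::euclidean_space, 'a::euclidean_space) atlas
    \<Rightarrow> ('a \<Rightarrow> 'b::euclidean_space) \<Rightarrow> 'a \<Rightarrow> 'a \<Rightarrow> 'b" where
  "mdiff A f p X =
     (THE y. \<exists>U \<phi> u w. (U, \<phi>) \<in> A \<and> u \<in> U \<and> \<phi> u = p \<and>
        frechet_derivative \<phi> (at u) w = X \<and>
        frechet_derivative (\<lambda>x. f (\<phi> x)) (at u) w = y)"

definition unit_tangent_field :: "'a::euclidean_space set \<Rightarrow> ('m::euclidean_space, 'a) atlas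
    \<Rightarrow> ('a \<Rightarrow> 'a) \<Rightarrow> bool" where
  "unit_tangent_field S A v \<longleftrightarrow>
     (\<forall>p\<in>S. v p \<in> tangent_space A p \<and> norm (v p) = 1) \<and>
     (\<forall>(U, \<phi>)\<in>A. C2_on U (\<lambda>u. v (\<phi> u)))"

section \<open>Curvature of the induced metric\<close>

definition tangential_part :: "('m::euclidean_space, 'a::euclidean_space) atlas \<Rightarrow> 'a \<Rightarrow> 'a \<Rightarrow> 'a"
  where
  "tangential_part A p w =
     (THE t. t \<in> tangent_space A p \<and> (\<forall>z\<in>tangent_space A p. (w - t) \<bullet> z = 0))"

text \<open>The Levi-Civita connection of the induced metric is the tangential part of the ambient
  directional derivative, and the Lie bracket of tangent fields is the commutator of their ambient
  directional derivatives.\<close>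

definition cov_deriv :: "('m::euclidean_space, 'a::euclidean_space) atlas
    \<Rightarrow> ('a \<Rightarrow> 'a) \<Rightarrow> ('a \<Rightarrow> 'a) \<Rightarrow> 'a \<Rightarrow> 'a" where
  "cov_deriv A X Y p = tangential_part A p (mdiff A Y p (X p))"

definition lie_bracket :: "('m::euclidean_space, 'a::euclidean_space) atlas
    \<Rightarrow> ('a \<Rightarrow> 'a) \<Rightarrow> ('a \<Rightarrow> 'a) \<Rightarrow> 'a \<Rightarrow> 'a" where
  "lie_bracket A X Y p = mdiff A Y p (X p) - mdiff A X p (Y p)"

definition riemann :: "('m::euclidean_space, 'a::euclidean_space) atlas
    \<Rightarrow> ('a \<Rightarrow> 'a) \<Rightarrow> ('a \<Rightarrow> 'a) \<Rightarrow> ('a \<Rightarrow> 'a) \<Rightarrow> 'a \<Rightarrow> 'a" where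
  "riemann A X Y Z p =
     cov_deriv A X (cov_deriv A Y Z) p - cov_deriv A Y (cov_deriv A X Z) p
       - cov_deriv A (lie_bracket A X Y) Z p"

text \<open>Curvature is expressed through tangent vector fields rather than through the coefficients of
  the metric in coordinates: the induced metric of a C2 submanifold is only C1, so its Christoffel
  symbols need not be differentiable.  All terms below exist if \<open>X\<close> is C1 and \<open>Y\<close> is C2 as maps
  into the ambient space, and the value at \<open>p\<close> then depends only on the plane spanned by \<open>X p\<close>
  and \<open>Y p\<close>.  The sign is the one for which round spheres have positive curvature.\<close>

definition sectional_curvature :: "('m::euclidean_space, 'a::euclidean_space) atlas
    \<Rightarrow> ('a \<Rightarrow> 'a) \<Rightarrow> ('a \<Rightarrow> 'a) \<Rightarrow> 'a \<Rightarrow> real" where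
  "sectional_curvature A X Y p =
     (riemann A X Y Y p \<bullet> X p) / ((norm (X p))\<^sup>2 * (norm (Y p))\<^sup>2 - (X p \<bullet> Y p)\<^sup>2)"

section \<open>The space of oriented lines\<close>

definition TSphere :: "('a::euclidean_space \<times> 'a) set" where
  "TSphere = {(\<xi>, \<eta>). norm \<xi> = 1 \<and> \<xi> \<bullet> \<eta> = 0}"

definition Phi :: "('a::euclidean_space \<Rightarrow> 'a) \<Rightarrow> 'a \<Rightarrow> 'a \<times> 'a" where
  "Phi v p = (v p, p - (v p \<bullet> p) *\<^sub>R v p)"

text \<open>The tautological form is the restriction to \<open>TSphere\<close> of a 1-form on the ambient space
  (\<open>fst X\<close> is the image of the tangent vector \<open>X\<close> under the differential of the projection
  \<open>fst\<close>).  Exterior derivatives commute with restriction, so the symplectic form is computed in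
  the ambient space and evaluated on tangent vectors only.\<close>

definition theta :: "'a::euclidean_space \<times> 'a \<Rightarrow> 'a \<times> 'a \<Rightarrow> real" where
  "theta q X = fst X \<bullet> snd q"

definition ext_deriv :: "('b::euclidean_space \<Rightarrow> 'b \<Rightarrow> real) \<Rightarrow> 'b \<Rightarrow> 'b \<Rightarrow> 'b \<Rightarrow> real" where
  "ext_deriv \<omega> q X Y =
     frechet_derivative (\<lambda>z. \<omega> z Y) (at q) X - frechet_derivative (\<lambda>z. \<omega> z X) (at q) Y"

definition Omega :: "'a::euclidean_space \<times> 'a \<Rightarrow> 'a \<times> 'a \<Rightarrow> 'a \<times> 'a \<Rightarrow> real" where
  "Omega q X Y = - ext_deriv theta q X Y"

definition isotropic :: "('a::euclidean_space \<times> 'a) set \<Rightarrow> ('k::euclidean_space, 'a \<times> 'a) atlas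
    \<Rightarrow> bool" where
  "isotropic \<Gamma> G \<longleftrightarrow>
     (\<forall>q\<in>\<Gamma>. \<forall>X\<in>tangent_space G q. \<forall>Y\<in>tangent_space G q. Omega q X Y = 0)"

section \<open>The signed distance and the transported field\<close>

definition signed_distance :: "'a::euclidean_space set \<Rightarrow> ('a \<Rightarrow> 'a) \<Rightarrow> ('a \<Rightarrow> 'a) \<Rightarrow> 'a \<Rightarrow> real" where
  "signed_distance S2 v1 v2 p = (p - (inv_into S2 (Phi v2) \<circ> Phi v1) p) \<bullet> v1 p"

text \<open>The push-forward of \<open>v2\<close> under \<open>h = (Phi v1)\<^sup>-\<^sup>1 \<circ> Phi v2 : S2 \<rightarrow> S1\<close>; its value at \<open>p\<close> is
  the differential of \<open>h\<close> at \<open>h\<^sup>-\<^sup>1 p = ((Phi v2)\<^sup>-\<^sup>1 \<circ> Phi v1) p\<close> applied to \<open>v2\<close>.\<close>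

definition transported_field :: "'a::euclidean_space set \<Rightarrow> 'a set \<Rightarrow> ('k::euclidean_space, 'a) atlas
    \<Rightarrow> ('a \<Rightarrow> 'a) \<Rightarrow> ('a \<Rightarrow> 'a) \<Rightarrow> 'a \<Rightarrow> 'a" where
  "transported_field S1 S2 A2 v1 v2 p =
     (let q = (inv_into S2 (Phi v2) \<circ> Phi v1) p
      in mdiff A2 (inv_into S1 (Phi v1) \<circ> Phi v2) q (v2 q))"

end

theory Submission
  imports Defs
begin

text \<open>In a chart \<open>\<phi>\<close> of \<open>S1\<close> write \<open>v\<close> for the unit field. Isotropy of the image of \<open>Phi v\<close>
  says that \<open>dv(b) \<bullet> d\<phi>(c)\<close> is symmetric in \<open>b\<close> and \<open>c\<close>, that is, \<open>v\<close> is closed as a 1-form; since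
  \<open>v\<close> has length 1, its integral curves are geodesics. The point of \<open>S2\<close> on the same oriented line is
  \<open>\<phi> - \<mu> v\<close>, and if \<open>w\<close> is the direction in which its derivative is \<open>v\<close>, then \<open>V = d\<phi>(w)\<close>
  satisfies \<open>\<mu> dv(w) = V - (V \<bullet> v) v\<close>. So \<open>Q = dv(w)\<close> is tangent to \<open>S1\<close> and equals the covariant
  derivative of \<open>v\<close> along \<open>V\<close>. Differentiating \<open>\<mu> Q = V - (V \<bullet> v) v\<close> along \<open>v\<close> and using the
  symmetry of \<open>dv\<close> for the bracket term gives \<open>R(V, v, v, V) = (d\<mu>(v) - 1) (Q \<bullet> Q)\<close>, while
  the squared area of the parallelogram spanned by \<open>V\<close> and \<open>v\<close> is \<open>\<mu>\<^sup>2 (Q \<bullet> Q)\<close>.\<close>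

section \<open>Second derivatives\<close>

text \<open>The mean value inequality is applied to the difference of \<open>f\<close> between the
  parallel edges \<open>x + s t h + t k\<close> and \<open>x + s t h\<close>, with the expected
  value subtracted. Its derivative in \<open>s\<close> involves \<open>f'\<close> at points near
  \<open>x\<close>, where differentiability of \<open>f'\<close> at \<open>x\<close> controls it up
  to \<open>o(t)\<close>.\<close>

lemma second_difference_bound:
  fixes f :: "'m::euclidean_space \<Rightarrow> 'b::euclidean_space" and f' :: "'m \<Rightarrow> 'm \<Rightarrow>\<^sub>L 'b"
  assumes f: "\<forall>\<^sub>F z in nhds x. (f has_derivative blinfun_apply (f' z)) (at z)"
    and f': "(f' has_derivative f'') (at x)" and e: "e > 0"
  shows "\<forall>\<^sub>F t in at_right 0. norm (f (x + t *\<^sub>R h + t *\<^sub>R k) - f (x + t *\<^sub>R h) - f (x + t *\<^sub>R k) + f x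
           - t\<^sup>2 *\<^sub>R blinfun_apply (f'' k) h) \<le> t\<^sup>2 * (e * (2 * (norm h + norm k) * norm h))"
proof -
  from f obtain d1 where d1: "d1 > 0" "\<And>z. dist z x < d1 \<Longrightarrow> (f has_derivative blinfun_apply (f' z)) (at z)"
    unfolding eventually_nhds_metric by blast
  from f' e obtain d2 where d2: "d2 > 0"
    "\<And>z. norm (z - x) < d2 \<Longrightarrow> norm (f' z - f' x - f'' (z - x)) \<le> e * norm (z - x)"
    unfolding has_derivative_at_alt by blast
  have lin: "linear f''" using f' by (rule has_derivative_linear)
  \<comment> \<open>The summand 1 keeps \<open>N\<close> positive when \<open>h = k = 0\<close>. For
    \<open>t < d\<close> the whole parallelogram lies where \<open>f\<close> has derivative
    \<open>f'\<close> and where the estimate on \<open>f'\<close> holds.\<close>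
  define N where "N = norm h + norm k + 1"
  have N: "N > 0" by (simp add: N_def add_nonneg_pos)
  define d where "d = min d1 d2 / N"
  have "d > 0" using d1 d2 N by (simp add: d_def)
  have "norm (f (x + t *\<^sub>R h + t *\<^sub>R k) - f (x + t *\<^sub>R h) - f (x + t *\<^sub>R k) + f x
           - t\<^sup>2 *\<^sub>R blinfun_apply (f'' k) h) \<le> t\<^sup>2 * (e * (2 * (norm h + norm k) * norm h))"
    if t: "0 < t" "t < d" for t
  proof -
    have small: "norm ((s * t) *\<^sub>R h + (c * t) *\<^sub>R k) \<le> t * (norm h + norm k)"
      "norm ((s * t) *\<^sub>R h + (c * t) *\<^sub>R k) < min d1 d2"
      if "0 \<le> s" "s \<le> 1" "0 \<le> c" "c \<le> 1" for s c
    proof -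
      have "norm ((s * t) *\<^sub>R h + (c * t) *\<^sub>R k) \<le> s * t * norm h + c * t * norm k"
        using norm_triangle_ineq[of "(s * t) *\<^sub>R h" "(c * t) *\<^sub>R k"] that t by (simp add: abs_mult)
      also have "\<dots> \<le> 1 * t * norm h + 1 * t * norm k"
        using that t by (intro add_mono mult_right_mono) auto
      finally show 1: "norm ((s * t) *\<^sub>R h + (c * t) *\<^sub>R k) \<le> t * (norm h + norm k)"
        by (simp add: algebra_simps)
      also have "\<dots> < t * N" using t by (simp add: N_def)
      also have "\<dots> < d * N" using t N by simp
      also have "\<dots> = min d1 d2" using N by (simp add: d_def)
      finally show "norm ((s * t) *\<^sub>R h + (c * t) *\<^sub>R k) < min d1 d2" .
    qed
    \<comment> \<open>The values \<open>c = 0\<close> and \<open>c = 1\<close> give the two edges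
      parallel to \<open>h\<close>, and \<open>s\<close> runs along them. Thus
      \<open>G 1 - G 0\<close> is the second difference minus its predicted value.\<close>
    define z where "z s c = x + ((s * t) *\<^sub>R h + (c * t) *\<^sub>R k)" for s c
    define G where "G s = f (z s 1) - f (z s 0) - (s * t\<^sup>2) *\<^sub>R blinfun_apply (f'' k) h" for s
    define G' where "G' s r = r *\<^sub>R (t *\<^sub>R (f' (z s 1) h - f' (z s 0) h) - t\<^sup>2 *\<^sub>R blinfun_apply (f'' k) h)" for s r
    have zd: "((\<lambda>s. z s c) has_derivative (\<lambda>r. (r * t) *\<^sub>R h)) (at s)" for s c
      unfolding z_def by (auto intro!: derivative_eq_intros)
    have fz: "((\<lambda>s. f (z s c)) has_derivative (\<lambda>r. f' (z s c) ((r * t) *\<^sub>R h))) (at s)"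
      if "0 \<le> s" "s \<le> 1" "0 \<le> c" "c \<le> 1" for s c
      using small(2)[OF that]
      by (intro has_derivative_compose[OF zd] d1) (auto simp: z_def dist_norm)
    have GD: "(G has_derivative G' s) (at s)" if "0 \<le> s" "s \<le> 1" for s
    proof -
      have "((\<lambda>s. (s * t\<^sup>2) *\<^sub>R blinfun_apply (f'' k) h) has_derivative
          (\<lambda>r. (r * t\<^sup>2) *\<^sub>R blinfun_apply (f'' k) h)) (at s)"
        by (auto intro!: derivative_eq_intros)
      from has_derivative_diff[OF has_derivative_diff[OF fz[OF that, of 1] fz[OF that, of 0]] this]
      have "(G has_derivative (\<lambda>r. f' (z s 1) ((r * t) *\<^sub>R h) - f' (z s 0) ((r * t) *\<^sub>R h)
          - (r * t\<^sup>2) *\<^sub>R blinfun_apply (f'' k) h)) (at s)"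
        unfolding G_def by simp
      moreover have "f' (z s 1) ((r * t) *\<^sub>R h) - f' (z s 0) ((r * t) *\<^sub>R h)
          - (r * t\<^sup>2) *\<^sub>R blinfun_apply (f'' k) h = G' s r" for r
        unfolding G'_def by (simp only: blinfun.scaleR_right scaleR_diff_right scaleR_scaleR)
      ultimately show ?thesis by (simp only:)
    qed
    have "\<exists>s\<in>{0<..<1}. norm (G 1 - G 0) \<le> norm (G' s (1 - 0))"
    proof (rule mvt_general[where f = G and f' = G'])
      show "continuous_on {0..1} G"
      proof (rule has_derivative_continuous_on[where f' = G'])
        fix s :: real assume "s \<in> {0..1}"
        then show "(G has_derivative G' s) (at s within {0..1})"
          by (auto intro: has_derivative_at_withinI[OF GD])
      qed
    next
      fix s :: real assume "0 < s" "s < 1"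
      then show "(G has_derivative G' s) (at s)" by (intro GD) auto
    qed simp
    then obtain s where s: "0 < s" "s < 1" "norm (G 1 - G 0) \<le> norm (G' s 1)" by auto
    \<comment> \<open>This is the remainder in the first-order expansion of \<open>f'\<close> at
      \<open>x\<close>. The linear parts on the two edges differ by exactly \<open>t\<close> times
      \<open>f'' k\<close>, which cancels the subtracted term, so \<open>G' s 1\<close> consists of
      remainders.\<close>
    define E where "E c = f' (z s c) - f' x - f'' (z s c - x)" for c
    have E: "norm (E c) \<le> e * (t * (norm h + norm k))" if "0 \<le> c" "c \<le> 1" for c
    proof -
      have "norm (E c) \<le> e * norm (z s c - x)"
        unfolding E_def using small(2)[of s c] s that by (intro d2) (auto simp: z_def)
      also have "\<dots> \<le> e * (t * (norm h + norm k))"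
        using small(1)[of s c] s that e by (intro mult_left_mono) (auto simp: z_def)
      finally show ?thesis .
    qed
    have "f'' (z s 1 - x) - f'' (z s 0 - x) = t *\<^sub>R f'' k"
      by (simp add: z_def linear_add[OF lin] linear_scale[OF lin])
    then have "f' (z s 1) - f' (z s 0) - t *\<^sub>R f'' k = E 1 - E 0"
      by (simp add: E_def algebra_simps)
    then have "t *\<^sub>R blinfun_apply (E 1 - E 0) h = G' s 1"
      unfolding G'_def by (metis (no_types, lifting) blinfun.diff_left blinfun.scaleR_left
        power2_eq_square scaleR_one scaleR_right_diff_distrib scaleR_scaleR)
    then have "norm (G' s 1) = t * norm (blinfun_apply (E 1 - E 0) h)" using t(1)
      by (metis abs_of_pos norm_scaleR)
    also have "\<dots> \<le> t * (norm (E 1 - E 0) * norm h)"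
      using t by (intro mult_left_mono norm_blinfun) auto
    also have "\<dots> \<le> t * ((e * (t * (norm h + norm k)) + e * (t * (norm h + norm k))) * norm h)"
      using t E[of 0] E[of 1] norm_triangle_ineq4[of "E 1" "E 0"]
      by (intro mult_left_mono mult_right_mono) auto
    also have "\<dots> = t\<^sup>2 * (e * (2 * (norm h + norm k) * norm h))"
      by (simp add: algebra_simps power2_eq_square)
    finally show ?thesis using s(3) by (simp add: G_def z_def algebra_simps)
  qed
  then show ?thesis unfolding eventually_at_right[OF zero_less_one]
    using \<open>d > 0\<close> by (intro exI[of _ d]) auto
qed

text \<open>Interchanging \<open>h\<close> and \<open>k\<close> does not change the second
  difference, so both mixed values approximate the same quantity up to \<open>e\<close> times a
  constant; then \<open>e\<close> tends to 0.\<close>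

lemma symmetric_second_derivative:
  fixes f :: "'m::euclidean_space \<Rightarrow> 'b::euclidean_space" and f' :: "'m \<Rightarrow> 'm \<Rightarrow>\<^sub>L 'b"
  assumes f: "\<forall>\<^sub>F z in nhds x. (f has_derivative blinfun_apply (f' z)) (at z)"
    and f': "(f' has_derivative f'') (at x)"
  shows "blinfun_apply (f'' h) k = blinfun_apply (f'' k) h"
proof -
  define C where "C = 2 * (norm h + norm k) * norm h + 2 * (norm h + norm k) * norm k"
  have C: "C \<ge> 0" by (simp add: C_def)
  have le: "norm (blinfun_apply (f'' h) k - blinfun_apply (f'' k) h) \<le> e * C" if e: "e > 0" for e
  proof -
    have "\<forall>\<^sub>F t in at_right (0::real). t > 0"
      by (simp add: eventually_at_right_less)
    from eventually_happens[OF eventually_conj[OF this eventually_conj[OF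
        second_difference_bound[OF f f' e, of h k] second_difference_bound[OF f f' e, of k h]]]]
    obtain t where t: "t > 0" and
      1: "norm (f (x + t *\<^sub>R h + t *\<^sub>R k) - f (x + t *\<^sub>R h) - f (x + t *\<^sub>R k) + f x
           - t\<^sup>2 *\<^sub>R blinfun_apply (f'' k) h) \<le> t\<^sup>2 * (e * (2 * (norm h + norm k) * norm h))" and
      2: "norm (f (x + t *\<^sub>R k + t *\<^sub>R h) - f (x + t *\<^sub>R k) - f (x + t *\<^sub>R h) + f x
           - t\<^sup>2 *\<^sub>R blinfun_apply (f'' h) k) \<le> t\<^sup>2 * (e * (2 * (norm k + norm h) * norm k))"
      by (auto simp: trivial_limit_at_right_real)
    define S where "S = f (x + t *\<^sub>R h + t *\<^sub>R k) - f (x + t *\<^sub>R h) - f (x + t *\<^sub>R k) + f x"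
    have S': "f (x + t *\<^sub>R k + t *\<^sub>R h) - f (x + t *\<^sub>R k) - f (x + t *\<^sub>R h) + f x = S"
      by (simp add: S_def algebra_simps)
    have "t\<^sup>2 * norm (blinfun_apply (f'' h) k - blinfun_apply (f'' k) h)
        = norm ((S - t\<^sup>2 *\<^sub>R blinfun_apply (f'' k) h) - (S - t\<^sup>2 *\<^sub>R blinfun_apply (f'' h) k))"
      by (simp flip: scaleR_diff_right)
    also have "\<dots> \<le> t\<^sup>2 * (e * (2 * (norm h + norm k) * norm h)) + t\<^sup>2 * (e * (2 * (norm k + norm h) * norm k))"
      using norm_triangle_ineq4 1[folded S_def] 2[unfolded S'] by (smt (verit, best))
    also have "\<dots> = t\<^sup>2 * (e * C)" by (simp add: C_def algebra_simps)
    finally show ?thesis using t by simp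
  qed
  have "norm (blinfun_apply (f'' h) k - blinfun_apply (f'' k) h) \<le> 0"
  proof (rule field_le_epsilon)
    fix e :: real assume "e > 0"
    \<comment> \<open>The denominator is \<open>C + 1\<close> because \<open>C\<close> vanishes for
      \<open>h = k = 0\<close>.\<close>
    then have "e / (C + 1) > 0" "e / (C + 1) * C \<le> e"
      using C by (auto simp: field_simps)
    then show "norm (blinfun_apply (f'' h) k - blinfun_apply (f'' k) h) \<le> 0 + e"
      using le[of "e / (C + 1)"] by linarith
  qed
  then show ?thesis by simp
qed

text \<open>A pointwise weakening of \<open>C2_on\<close>. It gives the symmetry of the second
  derivative, and it composes without tracking domains or the continuity of second
  derivatives.\<close>

definition twice_differentiable_at :: "('m::euclidean_space \<Rightarrow> 'b::euclidean_space) \<Rightarrow> 'm \<Rightarrow> bool" where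
  "twice_differentiable_at f x \<longleftrightarrow> (\<exists>f' :: 'm \<Rightarrow> 'm \<Rightarrow>\<^sub>L 'b.
     (\<forall>\<^sub>F z in nhds x. (f has_derivative blinfun_apply (f' z)) (at z)) \<and> f' differentiable (at x))"

lemma C2_on_imp_twice_differentiable_at:
  assumes "C2_on U f" "open U" "x \<in> U"
  shows "twice_differentiable_at f x"
proof -
  obtain f' f'' where "\<forall>x\<in>U. (f has_derivative blinfun_apply (f' x)) (at x) \<and>
      (f' has_derivative blinfun_apply (f'' x)) (at x)"
    using assms(1) unfolding C2_on_def by blast
  then show ?thesis using assms(2,3) unfolding twice_differentiable_at_def
    by (intro exI[of _ f']) (auto simp: eventually_nhds intro: differentiableI)
qed

lemma has_derivative_cong_nhds:
  assumes "(f has_derivative D) (at x)" "\<forall>\<^sub>F z in nhds x. f z = g z"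
  shows "(g has_derivative D) (at x)"
proof (rule has_derivative_transform_eventually[OF assms(1)])
  show "\<forall>\<^sub>F z in at x. f z = g z" 
    using assms(2) unfolding eventually_at_filter by eventually_elim simp
  show "f x = g x" using assms(2) by (rule eventually_nhds_x_imp_x)
qed simp

lemma twice_differentiable_at_imp_differentiable:
  "twice_differentiable_at f x \<Longrightarrow> f differentiable (at x)"
  unfolding twice_differentiable_at_def by (blast intro: differentiableI dest: eventually_nhds_x_imp_x)

lemma twice_differentiable_at_cong:
  assumes "twice_differentiable_at f x" "\<forall>\<^sub>F z in nhds x. f z = g z"
  shows "twice_differentiable_at g x"
proof -
  obtain f' where f': "\<forall>\<^sub>F z in nhds x. (f has_derivative blinfun_apply (f' z)) (at z)"
    "f' differentiable (at x)"
    using assms(1) unfolding twice_differentiable_at_def by blast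
  have "\<forall>\<^sub>F z in nhds x. \<forall>\<^sub>F y in nhds z. f y = g y"
    using assms(2) by (simp add: eventually_eventually)
  with f'(1) have "\<forall>\<^sub>F z in nhds x. (g has_derivative blinfun_apply (f' z)) (at z)"
    by eventually_elim (rule has_derivative_cong_nhds)
  then show ?thesis using f'(2) unfolding twice_differentiable_at_def by blast
qed

lemma eventually_nhds_compose:
  assumes "isCont g x" "eventually P (nhds (g x))"
  shows "\<forall>\<^sub>F z in nhds x. P (g z)"
  using assms unfolding isCont_def tendsto_at_iff_tendsto_nhds by (simp add: filterlim_iff)

text \<open>Near \<open>x\<close> the derivative of the composite is the product of the linear maps
  \<open>f' (g z)\<close> and \<open>g' z\<close>, a bounded bilinear expression in two functions
  differentiable at \<open>x\<close>.\<close>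

lemma twice_differentiable_at_compose:
  fixes f :: "'n::euclidean_space \<Rightarrow> 'b::euclidean_space" and g :: "'m::euclidean_space \<Rightarrow> 'n"
  assumes "twice_differentiable_at g x" "twice_differentiable_at f (g x)"
  shows "twice_differentiable_at (\<lambda>z. f (g z)) x"
proof -
  obtain g' where g': "\<forall>\<^sub>F z in nhds x. (g has_derivative blinfun_apply (g' z)) (at z)"
    "g' differentiable (at x)"
    using assms(1) unfolding twice_differentiable_at_def by blast
  obtain f' where f': "\<forall>\<^sub>F z in nhds (g x). (f has_derivative blinfun_apply (f' z)) (at z)"
    "f' differentiable (at (g x))"
    using assms(2) unfolding twice_differentiable_at_def by blast
  have gd: "g differentiable (at x)"
    using assms(1) by (rule twice_differentiable_at_imp_differentiable)
  then have "isCont g x" by (rule differentiable_imp_continuous_within)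
  from eventually_nhds_compose[OF this f'(1)] g'(1)
  have "\<forall>\<^sub>F z in nhds x. ((\<lambda>z. f (g z)) has_derivative blinfun_apply (f' (g z) o\<^sub>L g' z)) (at z)"
  proof eventually_elim
    case (elim z)
    from has_derivative_compose[OF elim(2,1)] show ?case by (simp add: blinfun_compose.rep_eq o_def)
  qed
  moreover have "(\<lambda>z. f' (g z) o\<^sub>L g' z) differentiable (at x)"
  proof -
    have "(\<lambda>z. f' (g z)) differentiable (at x)"
      using differentiable_chain_at[OF gd f'(2)] by (simp add: o_def)
    then show ?thesis using g'(2) bounded_bilinear.FDERIV[OF bounded_bilinear_blinfun_compose]
      unfolding differentiable_def by blast
  qed
  ultimately show ?thesis unfolding twice_differentiable_at_def
    by (intro exI[of _ "\<lambda>z. f' (g z) o\<^sub>L g' z"]) simp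
qed

text \<open>With a left inverse \<open>P\<close> of \<open>L x\<close> and
  \<open>d = g - g x\<close>, the equation becomes \<open>d = e - N d\<close>, where
  \<open>e\<close> is differentiable and \<open>N\<close> vanishes at \<open>x\<close>. The term
  \<open>N d\<close> turns out to be of higher order, so \<open>d\<close> has the same derivative as
  \<open>e\<close>.\<close>

lemma differentiable_solve_linear:
  fixes L :: "'m::euclidean_space \<Rightarrow> 'n::euclidean_space \<Rightarrow>\<^sub>L 'b::euclidean_space"
  assumes L: "L differentiable (at x)" and inj: "inj (blinfun_apply (L x))"
    and f: "f differentiable (at x)" and g: "\<forall>\<^sub>F z in nhds x. blinfun_apply (L z) (g z) = f z"
  shows "g differentiable (at x)"
proof -
  obtain P where P: "linear P" "P \<circ> blinfun_apply (L x) = id"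
    using linear_injective_left_inverse[OF _ inj] blinfun.bounded_linear_right bounded_linear.linear by blast
  have bP: "bounded_linear P" using P(1) by (simp add: linear_conv_bounded_linear)
  define d where "d z = g z - g x" for z
  define e where "e z = P (f z - L z (g x))" for z
  define N where "N z = (Blinfun P o\<^sub>L L z) - id_blinfun" for z
  have N_apply: "blinfun_apply (N z) y = P (L z y) - y" for z y
    by (simp add: N_def blinfun.diff_left bounded_linear_Blinfun_apply[OF bP])
  have Nx: "N x = 0"
    by (rule blinfun_eqI) (use P(2) in \<open>simp add: N_apply fun_eq_iff\<close>)
  have "L x (g x) = f x" using g by (rule eventually_nhds_x_imp_x)
  then have ex: "e x = 0" by (simp add: e_def linear_0[OF P(1)])
  obtain L' where L': "(L has_derivative L') (at x)" using L by (auto simp: differentiable_def)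
  have Nd: "(N has_derivative (\<lambda>h. Blinfun P o\<^sub>L L' h)) (at x)"
    unfolding N_def using L'
    by (auto intro!: derivative_eq_intros bounded_linear.has_derivative[OF
          bounded_bilinear.bounded_linear_right[OF bounded_bilinear_blinfun_compose]])
  have ed: "e differentiable (at x)"
  proof -
    obtain f' where f': "(f has_derivative f') (at x)" using f by (auto simp: differentiable_def)
    have "((\<lambda>z. L z (g x)) has_derivative (\<lambda>h. L' h (g x))) (at x)"
      by (rule bounded_linear.has_derivative[OF blinfun.bounded_linear_left L'])
    from bounded_linear.has_derivative[OF bP has_derivative_diff[OF f' this]]
    show ?thesis unfolding e_def by (rule differentiableI)
  qed
  have econt: "(e \<longlongrightarrow> 0) (at x)"
    using differentiable_imp_continuous_within[OF ed] ex by (simp add: isCont_def)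
  have Ncont: "(N \<longlongrightarrow> 0) (at x)"
    using has_derivative_continuous[OF Nd] Nx by (simp add: isCont_def)
  have eq: "\<forall>\<^sub>F z in at x. d z = e z - N z (d z)"
    using g unfolding eventually_at_filter
  proof eventually_elim
    case (elim z)
    show ?case using elim by (simp add: e_def d_def N_apply blinfun.diff_right linear_diff[OF P(1)])
  qed
  \<comment> \<open>Once \<open>norm (N z) < 1/2\<close>, the term \<open>N z (d z)\<close> is
    absorbed into the left-hand side. This already yields the continuity of \<open>g\<close> at
    \<open>x\<close>.\<close>
  have bd: "\<forall>\<^sub>F z in at x. norm (d z) \<le> 2 * norm (e z)"
    using eq tendstoD[OF Ncont half_gt_zero[OF zero_less_one]]
  proof eventually_elim
    case (elim z)
    then have *: "d z = e z - N z (d z)" and "norm (N z) < 1/2" by simp_all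
    then have "norm (N z (d z)) \<le> 1/2 * norm (d z)"
      by (meson norm_blinfun order_trans mult_right_mono norm_ge_zero less_imp_le)
    moreover have "norm (d z) \<le> norm (e z) + norm (N z (d z))"
      using * norm_triangle_ineq4 by metis
    ultimately show "norm (d z) \<le> 2 * norm (e z)" by linarith
  qed
  define B where "B = onorm (\<lambda>h. Blinfun P o\<^sub>L L' h) + 1"
  have Nlip: "\<forall>\<^sub>F z in at x. norm (N z) \<le> B * norm (z - x)"
  proof -
    obtain \<delta> where \<delta>: "\<delta> > 0" "\<And>z. norm (z - x) < \<delta> \<Longrightarrow>
        norm (N z - N x - (Blinfun P o\<^sub>L L' (z - x))) \<le> 1 * norm (z - x)"
      using Nd zero_less_one unfolding has_derivative_at_alt by blast
    have "norm (N z) \<le> B * norm (z - x)" if "norm (z - x) < \<delta>" for z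
      using \<delta>(2)[OF that] onorm[OF has_derivative_bounded_linear[OF Nd], of "z - x"]
        norm_triangle_sub[of "N z" "Blinfun P o\<^sub>L L' (z - x)"]
      by (simp add: B_def Nx algebra_simps)
    then show ?thesis using \<delta>(1) unfolding eventually_at by (auto simp: dist_norm)
  qed
  \<comment> \<open>An operator of size \<open>O(norm (z - x))\<close> acts on a vector tending to
    0, so the product is \<open>o(norm (z - x))\<close>.\<close>
  have "((\<lambda>z. N z (d z)) has_derivative (\<lambda>h. 0)) (at x)"
  proof (unfold has_derivative_at_within, intro conjI)
    show "((\<lambda>y. (blinfun_apply (N y) (d y) - blinfun_apply (N x) (d x) - 0) /\<^sub>R norm (y - x)) \<longlongrightarrow> 0) (at x)"
    proof (rule Lim_null_comparison)
      have "((\<lambda>z. B * (2 * norm (e z))) \<longlongrightarrow> B * (2 * norm (0::'n))) (at x)"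
        by (intro tendsto_intros econt)
      then show "((\<lambda>z. B * (2 * norm (e z))) \<longlongrightarrow> 0) (at x)" by simp
      have "\<forall>\<^sub>F z in at x. z \<noteq> x" by (simp add: eventually_at_filter)
      then show "\<forall>\<^sub>F z in at x. norm ((blinfun_apply (N z) (d z) - blinfun_apply (N x) (d x) - 0) /\<^sub>R norm (z - x)) \<le> B * (2 * norm (e z))"
        using bd Nlip
      proof eventually_elim
        case (elim z)
        have "norm (N z (d z)) \<le> (B * norm (z - x)) * (2 * norm (e z))"
          using elim(2,3) by (meson norm_blinfun order_trans mult_mono norm_ge_zero)
        then show ?case using elim(1) by (simp add: Nx field_simps)
      qed
    qed
  qed simp
  moreover obtain e' where "(e has_derivative e') (at x)" using ed by (auto simp: differentiable_def)
  ultimately have "((\<lambda>z. g x + (e z - N z (d z))) has_derivative (\<lambda>h. 0 + (e' h - 0))) (at x)"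
    by (intro has_derivative_add has_derivative_diff has_derivative_const)
  then have "((\<lambda>z. g x + (e z - N z (d z))) has_derivative e') (at x)" by simp
  then have "(g has_derivative e') (at x)"
  proof (rule has_derivative_transform_eventually)
    show "\<forall>\<^sub>F z in at x. g x + (e z - N z (d z)) = g z"
      using eq by eventually_elim (simp add: d_def)
  qed (simp_all add: ex Nx)
  then show ?thesis by (rule differentiableI)
qed

section \<open>Charts\<close>

context
  fixes S :: "'a::euclidean_space set" and A :: "('m::euclidean_space, 'a) atlas"
  assumes imm: "immersed_submanifold S A"
begin

lemma chart_open: "(U, \<phi>) \<in> A \<Longrightarrow> open U"
  and chart_inj_on: "(U, \<phi>) \<in> A \<Longrightarrow> inj_on \<phi> U"
  and chart_C2_on: "(U, \<phi>) \<in> A \<Longrightarrow> C2_on U \<phi>"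
  and chart_immersion: "(U, \<phi>) \<in> A \<Longrightarrow> u \<in> U \<Longrightarrow> inj (frechet_derivative \<phi> (at u))"
  and chart_mem: "(U, \<phi>) \<in> A \<Longrightarrow> u \<in> U \<Longrightarrow> \<phi> u \<in> S"
proof -
  have 1: "\<forall>(U, \<phi>)\<in>A. open U \<and> inj_on \<phi> U \<and> C2_on U \<phi> \<and> (\<forall>u\<in>U. inj (frechet_derivative \<phi> (at u)))"
    and 2: "S = (\<Union>(U, \<phi>)\<in>A. \<phi> ` U)"
    using imm unfolding immersed_submanifold_def by simp_all
  show "(U, \<phi>) \<in> A \<Longrightarrow> open U" "(U, \<phi>) \<in> A \<Longrightarrow> inj_on \<phi> U" "(U, \<phi>) \<in> A \<Longrightarrow> C2_on U \<phi>"
    "(U, \<phi>) \<in> A \<Longrightarrow> u \<in> U \<Longrightarrow> inj (frechet_derivative \<phi> (at u))"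
    using 1 by auto
  show "(U, \<phi>) \<in> A \<Longrightarrow> u \<in> U \<Longrightarrow> \<phi> u \<in> S" using 2 by auto
qed

lemma chart_exists:
  assumes "p \<in> S"
  obtains U \<phi> u where "(U, \<phi>) \<in> A" "u \<in> U" "\<phi> u = p"
proof -
  have "S = (\<Union>(U, \<phi>)\<in>A. \<phi> ` U)"
    using imm unfolding immersed_submanifold_def by (elim conjE)
  then show ?thesis using assms that by auto
qed

lemma chart_twice_differentiable: "(U, \<phi>) \<in> A \<Longrightarrow> u \<in> U \<Longrightarrow> twice_differentiable_at \<phi> u"
  by (rule C2_on_imp_twice_differentiable_at[OF chart_C2_on chart_open])

lemma chart_has_derivative:
  assumes "(U, \<phi>) \<in> A" "u \<in> U"
  shows "(\<phi> has_derivative frechet_derivative \<phi> (at u)) (at u)"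
  using twice_differentiable_at_imp_differentiable[OF chart_twice_differentiable[OF assms]]
  by (simp add: frechet_derivative_works)

end

text \<open>The set used in \<open>C2_map\<close> is an open neighbourhood of \<open>u\<close>, on
  which \<open>inv_into W \<psi> (f (\<phi> x))\<close> serves as the local expression of
  \<open>f\<close>.\<close>

lemma C2_map_lift:
  fixes A :: "('m::euclidean_space, 'a) atlas" and B :: "('k::euclidean_space, 'b) atlas"
  assumes f: "C2_map A B f" and U: "(U, \<phi>) \<in> A" "u \<in> U"
    and W: "(W, \<psi>) \<in> B" "s \<in> W" "inj_on \<psi> W" "f (\<phi> u) = \<psi> s"
  obtains k where "twice_differentiable_at k u" "k u = s"
    "\<forall>\<^sub>F x in nhds u. x \<in> U \<and> k x \<in> W \<and> f (\<phi> x) = \<psi> (k x)"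
proof -
  define V where "V = {u\<in>U. f (\<phi> u) \<in> \<psi> ` W}"
  define k where "k = (\<lambda>u. inv_into W \<psi> (f (\<phi> u)))"
  have V: "open V" "C2_on V k"
    using f U(1) W(1) unfolding C2_map_def V_def k_def by blast+
  have u: "u \<in> V" using U W by (auto simp: V_def)
  show ?thesis
  proof
    show "twice_differentiable_at k u" by (rule C2_on_imp_twice_differentiable_at[OF V(2,1) u])
    show "k u = s" using W by (simp add: k_def)
    have "x \<in> U \<and> k x \<in> W \<and> f (\<phi> x) = \<psi> (k x)" if "x \<in> V" for x
      using that unfolding V_def k_def by (auto simp: inv_into_into f_inv_into_f)
    then show "\<forall>\<^sub>F x in nhds u. x \<in> U \<and> k x \<in> W \<and> f (\<phi> x) = \<psi> (k x)"
      using V(1) u unfolding eventually_nhds by blast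
  qed
qed

text \<open>The change of coordinates is the local expression of the identity, which is a C2 map of
  the manifold to itself; the chain rule then relates the differentials of the two charts.\<close>

lemma chart_transition:
  assumes A: "immersed_submanifold S A"
    and U: "(U, \<phi>) \<in> A" "u \<in> U" and W: "(W, \<psi>) \<in> A" "s \<in> W" "\<phi> u = \<psi> s"
  obtains k k' where "(k has_derivative k') (at u)" "k u = s" "\<forall>\<^sub>F x in nhds u. \<phi> x = \<psi> (k x)"
    "frechet_derivative \<phi> (at u) = (\<lambda>h. frechet_derivative \<psi> (at s) (k' h))"
proof -
  have "C2_map A A id" using A by (auto simp: immersed_submanifold_def)
  from C2_map_lift[OF this U W(1,2) chart_inj_on[OF A W(1)]] W(3)
  obtain k where k: "twice_differentiable_at k u" "k u = s"
    "\<forall>\<^sub>F x in nhds u. x \<in> U \<and> k x \<in> W \<and> id (\<phi> x) = \<psi> (k x)" by auto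
  from twice_differentiable_at_imp_differentiable[OF k(1)]
  obtain k' where k': "(k has_derivative k') (at u)" by (auto simp: differentiable_def)
  have eq: "\<forall>\<^sub>F x in nhds u. \<phi> x = \<psi> (k x)" using k(3) by eventually_elim simp
  have "((\<lambda>x. \<psi> (k x)) has_derivative (\<lambda>h. frechet_derivative \<psi> (at s) (k' h))) (at u)"
    using has_derivative_compose[OF k'] chart_has_derivative[OF A W(1,2)] k(2) by metis
  from has_derivative_cong_nhds[OF this] eq
  have "(\<phi> has_derivative (\<lambda>h. frechet_derivative \<psi> (at s) (k' h))) (at u)"
    by (simp add: eq_commute)
  from frechet_derivative_at[OF this] show ?thesis using that k' k(2) eq by metis
qed

text \<open>The definition of \<open>tangent_space\<close> collects vectors from all charts at the
  point. By the change of coordinates every other chart contributes vectors in the range of the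
  given one.\<close>

lemma tangent_space_chart:
  assumes A: "immersed_submanifold S A" and U: "(U, \<phi>) \<in> A" "u \<in> U"
  shows "tangent_space A (\<phi> u) = range (frechet_derivative \<phi> (at u))"
proof
  show "range (frechet_derivative \<phi> (at u)) \<subseteq> tangent_space A (\<phi> u)"
    using U unfolding tangent_space_def by blast
  show "tangent_space A (\<phi> u) \<subseteq> range (frechet_derivative \<phi> (at u))"
  proof
    fix X assume "X \<in> tangent_space A (\<phi> u)"
    then obtain W \<psi> s w where W: "(W, \<psi>) \<in> A" "s \<in> W" "\<psi> s = \<phi> u"
      and X: "X = frechet_derivative \<psi> (at s) w"
      unfolding tangent_space_def by blast
    from chart_transition[OF A W(1,2) U W(3)] obtain k'
      where "frechet_derivative \<psi> (at s) = (\<lambda>h. frechet_derivative \<phi> (at u) (k' h))"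
      by metis
    then show "X \<in> range (frechet_derivative \<phi> (at u))" using X by simp
  qed
qed

text \<open>This discharges the definite description in \<open>mdiff\<close>. In another chart the
  same tangent vector has coordinates \<open>w'\<close> with \<open>k' w' = w\<close>, because the
  differential of a chart is injective, and the chain rule then gives the same value.\<close>

lemma mdiff_chart:
  assumes A: "immersed_submanifold S A" and U: "(U, \<phi>) \<in> A" "u \<in> U"
    and f: "((\<lambda>x. f (\<phi> x)) has_derivative D) (at u)"
  shows "mdiff A f (\<phi> u) (frechet_derivative \<phi> (at u) w) = D w"
  unfolding mdiff_def
proof (rule the_equality)
  show "\<exists>W \<psi> s w'. (W, \<psi>) \<in> A \<and> s \<in> W \<and> \<psi> s = \<phi> u \<and>
      frechet_derivative \<psi> (at s) w' = frechet_derivative \<phi> (at u) w \<and>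
      frechet_derivative (\<lambda>x. f (\<psi> x)) (at s) w' = D w"
    using U frechet_derivative_at[OF f] by metis
  fix y
  assume "\<exists>W \<psi> s w'. (W, \<psi>) \<in> A \<and> s \<in> W \<and> \<psi> s = \<phi> u \<and>
      frechet_derivative \<psi> (at s) w' = frechet_derivative \<phi> (at u) w \<and>
      frechet_derivative (\<lambda>x. f (\<psi> x)) (at s) w' = y"
  then obtain W \<psi> s w' where W: "(W, \<psi>) \<in> A" "s \<in> W" "\<psi> s = \<phi> u"
    and w: "frechet_derivative \<psi> (at s) w' = frechet_derivative \<phi> (at u) w"
    and y: "frechet_derivative (\<lambda>x. f (\<psi> x)) (at s) w' = y" by blast
  obtain k k' where k: "(k has_derivative k') (at s)" "k s = u" "\<forall>\<^sub>F x in nhds s. \<psi> x = \<phi> (k x)"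
    "frechet_derivative \<psi> (at s) = (\<lambda>h. frechet_derivative \<phi> (at u) (k' h))"
    using chart_transition[OF A W(1,2) U W(3)] by metis
  have "k' w' = w" using w k(4) chart_immersion[OF A U] by (auto dest: injD)
  have "((\<lambda>x. f (\<phi> (k x))) has_derivative (\<lambda>h. D (k' h))) (at s)"
    using has_derivative_compose[OF k(1), of "\<lambda>x. f (\<phi> x)" D] f k(2) by simp
  moreover have "\<forall>\<^sub>F x in nhds s. f (\<phi> (k x)) = f (\<psi> x)" using k(3) by eventually_elim simp
  ultimately have "((\<lambda>x. f (\<psi> x)) has_derivative (\<lambda>h. D (k' h))) (at s)"
    by (rule has_derivative_cong_nhds)
  from frechet_derivative_at[OF this] y \<open>k' w' = w\<close> show "y = D w" by metis
qed

lemma subspace_tangent_space: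
  assumes A: "immersed_submanifold S A" and "p \<in> S"
  shows "subspace (tangent_space A p)"
proof -
  obtain U \<phi> u where U: "(U, \<phi>) \<in> A" "u \<in> U" "\<phi> u = p"
    using chart_exists[OF A \<open>p \<in> S\<close>] .
  have "linear (frechet_derivative \<phi> (at u))"
    using chart_has_derivative[OF A U(1,2)] by (rule has_derivative_linear)
  then show ?thesis using tangent_space_chart[OF A U(1,2)] U(3)
    by (simp add: linear_subspace_image)
qed

lemma tangential_part_unique:
  assumes "subspace (tangent_space A p)"
    and "t \<in> tangent_space A p" "\<And>z. z \<in> tangent_space A p \<Longrightarrow> (w - t) \<bullet> z = 0"
  shows "tangential_part A p w = t"
  unfolding tangential_part_def
proof (rule the_equality)
  fix t' assume t': "t' \<in> tangent_space A p \<and> (\<forall>z\<in>tangent_space A p. (w - t') \<bullet> z = 0)"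
  then have "t' - t \<in> tangent_space A p" using subspace_diff[OF assms(1)] assms(2) by simp
  then have "(w - t) \<bullet> (t' - t) = 0" "(w - t') \<bullet> (t' - t) = 0" using assms(3) t' by blast+
  then have "(t' - t) \<bullet> (t' - t) = 0" by (simp add: inner_diff_left)
  then show "t' = t" by simp
qed (use assms in blast)

text \<open>Orthogonal decomposition shows that the tangential part exists. The equation removes the
  projections from covariant derivatives once these are paired with a tangent vector.\<close>

lemma inner_tangential_part:
  assumes T: "subspace (tangent_space A p)" and z: "z \<in> tangent_space A p"
  shows "tangential_part A p w \<bullet> z = w \<bullet> z"
proof -
  obtain t n where t: "t \<in> span (tangent_space A p)"
    "\<And>z. z \<in> span (tangent_space A p) \<Longrightarrow> orthogonal n z" "w = t + n"
    by (rule orthogonal_subspace_decomp_exists[of "tangent_space A p" w]) blast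
  then have t': "t \<in> tangent_space A p" "\<And>z. z \<in> tangent_space A p \<Longrightarrow> (w - t) \<bullet> z = 0"
    unfolding span_eq_iff[THEN iffD2, OF T] by (simp_all add: orthogonal_def)
  have "tangential_part A p w = t" by (rule tangential_part_unique[OF T t'])
  then show ?thesis using t'(2)[OF z] by (simp add: inner_diff_left)
qed

text \<open>Used to show that the coordinate vectors of the fields are differentiable: they solve a
  linear system whose coefficients are the first derivatives of an immersion.\<close>

lemma differentiable_solve_derivative:
  fixes f :: "'m::euclidean_space \<Rightarrow> 'b::euclidean_space" and w :: "'m \<Rightarrow> 'm"
  assumes f: "twice_differentiable_at f u" and inj: "inj (frechet_derivative f (at u))"
    and g: "g differentiable (at u)" and w: "\<forall>\<^sub>F x in nhds u. frechet_derivative f (at x) (w x) = g x"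
  shows "w differentiable (at u)"
proof -
  obtain f' where f': "\<forall>\<^sub>F x in nhds u. (f has_derivative blinfun_apply (f' x)) (at x)"
    "f' differentiable (at u)"
    using f unfolding twice_differentiable_at_def by blast
  from f'(1) have D: "\<forall>\<^sub>F x in nhds u. frechet_derivative f (at x) = blinfun_apply (f' x)"
    by eventually_elim (rule frechet_derivative_at[symmetric])
  show ?thesis
  proof (rule differentiable_solve_linear[OF f'(2) _ g])
    show "inj (blinfun_apply (f' u))" using inj eventually_nhds_x_imp_x[OF D] by simp
    show "\<forall>\<^sub>F x in nhds u. blinfun_apply (f' x) (w x) = g x"
      using D w by eventually_elim simp
  qed
qed

lemma unit_norm_has_derivative:
  assumes "((\<lambda>x. f x :: 'a::real_inner) has_derivative f') (at u)"
    and "\<forall>\<^sub>F x in nhds u. norm (f x) = 1"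
  shows "f' h \<bullet> f u = 0"
proof -
  have "((\<lambda>x. f x \<bullet> f x) has_derivative (\<lambda>h. f u \<bullet> f' h + f' h \<bullet> f u)) (at u)"
    by (rule has_derivative_inner[OF assms(1) assms(1)])
  moreover have "\<forall>\<^sub>F x in nhds u. f x \<bullet> f x = 1"
    using assms(2) by eventually_elim (simp add: dot_square_norm)
  ultimately have "((\<lambda>x. 1::real) has_derivative (\<lambda>h. f u \<bullet> f' h + f' h \<bullet> f u)) (at u)"
    by (rule has_derivative_cong_nhds)
  from has_derivative_unique[OF this has_derivative_const]
  have "f u \<bullet> f' h + f' h \<bullet> f u = 0" by meson
  then show ?thesis by (simp add: inner_commute)
qed

section \<open>Curvature along a closed unit field\<close>

text \<open>Here the second submanifold is present only through \<open>V\<close>,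
  \<open>\<mu>\<close> and the relation \<open>shape\<close>. The functions \<open>a\<close> and
  \<open>w\<close> are the coordinates of \<open>v\<close> and \<open>V\<close> in the chart, and
  \<open>nz\<close> makes \<open>V\<close> and \<open>v\<close> linearly independent at the
  point.\<close>

lemma sectional_curvature_closed_field:
  fixes S :: "'a::euclidean_space set" and A :: "('m::euclidean_space, 'a) atlas"
    and \<mu> :: "'a \<Rightarrow> real"
  assumes A: "immersed_submanifold S A" and U: "(U, \<phi>) \<in> A" "u \<in> U"
    and unit: "\<And>x. x \<in> U \<Longrightarrow> norm (v (\<phi> x)) = 1"
    and va: "\<And>x. x \<in> U \<Longrightarrow> v (\<phi> x) = frechet_derivative \<phi> (at x) (a x)"
    and Vw: "\<And>x. x \<in> U \<Longrightarrow> V (\<phi> x) = frechet_derivative \<phi> (at x) (w x)"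
    and v': "\<And>x. x \<in> U \<Longrightarrow> ((\<lambda>x. v (\<phi> x)) has_derivative v' x) (at x)"
    and a: "a differentiable (at u)" and w: "w differentiable (at u)"
    and closed: "\<And>x b c. x \<in> U \<Longrightarrow>
      v' x b \<bullet> frechet_derivative \<phi> (at x) c = v' x c \<bullet> frechet_derivative \<phi> (at x) b"
    and \<mu>': "((\<lambda>x. \<mu> (\<phi> x)) has_derivative \<mu>') (at u)"
    and \<mu>: "\<And>x. x \<in> U \<Longrightarrow> \<mu> (\<phi> x) \<noteq> 0"
    and shape: "\<And>x. x \<in> U \<Longrightarrow>
      \<mu> (\<phi> x) *\<^sub>R v' x (w x) = V (\<phi> x) - (V (\<phi> x) \<bullet> v (\<phi> x)) *\<^sub>R v (\<phi> x)"
    and nz: "v' u (w u) \<noteq> 0"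
  shows "sectional_curvature A V v (\<phi> u) =
    (mdiff A \<mu> (\<phi> u) (v (\<phi> u)) - 1) / (\<mu> (\<phi> u))\<^sup>2"
proof -
  define D where "D x = frechet_derivative \<phi> (at x)" for x
  note va = va[folded D_def] and Vw = Vw[folded D_def] and closed = closed[folded D_def]
  have D: "(\<phi> has_derivative D x) (at x)" if "x \<in> U" for x
    unfolding D_def by (rule chart_has_derivative[OF A U(1) that])
  have linD: "linear (D x)" if "x \<in> U" for x using D[OF that] by (rule has_derivative_linear)
  have T: "tangent_space A (\<phi> x) = range (D x)" if "x \<in> U" for x
    unfolding D_def by (rule tangent_space_chart[OF A U(1) that])
  have sub: "subspace (tangent_space A (\<phi> x))" if "x \<in> U" for x
    by (rule subspace_tangent_space[OF A chart_mem[OF A U(1) that]])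
  have md: "mdiff A f (\<phi> x) (D x h) = f' h"
    if "x \<in> U" "((\<lambda>x. f (\<phi> x)) has_derivative f') (at x)" for f :: "'a \<Rightarrow> 'a" and f' x h
    unfolding D_def by (rule mdiff_chart[OF A U(1) that])
  have evU: "\<forall>\<^sub>F z in nhds x. z \<in> U" if "x \<in> U" for x
    using chart_open[OF A U(1)] that by (rule eventually_nhds_in_open)

  \<comment> \<open>Covariant derivatives of the unit field along itself and along
    \<open>V\<close>\<close>
  have orth: "v' x h \<bullet> v (\<phi> x) = 0" if x: "x \<in> U" for x h
  proof (rule unit_norm_has_derivative[OF v'[OF x]])
    show "\<forall>\<^sub>F x in nhds x. norm (v (\<phi> x)) = 1"
      using evU[OF x] by eventually_elim (rule unit)
  qed
  \<comment> \<open>Closedness exchanges \<open>a x\<close> and \<open>c\<close>, which leaves the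
    derivative of a unit field paired with the field itself.\<close>
  have geodesic: "v' x (a x) \<bullet> D x c = 0" if "x \<in> U" for x c
    using closed[OF that, of "a x" c] va[OF that] orth[OF that, of c] by simp
  have cov_vv: "cov_deriv A v v (\<phi> x) = 0" if x: "x \<in> U" for x
    unfolding cov_deriv_def va[OF x] md[OF x v'[OF x]]
  proof (rule tangential_part_unique[OF sub[OF x]])
    show "0 \<in> tangent_space A (\<phi> x)" using sub[OF x] by (rule subspace_0)
    show "(v' x (a x) - 0) \<bullet> z = 0" if "z \<in> tangent_space A (\<phi> x)" for z
      using that geodesic[OF x] T[OF x] by auto
  qed
  define Q where "Q x = v' x (w x)" for x
  \<comment> \<open>Dividing \<open>shape\<close> by \<open>\<mu>\<close> exhibits \<open>Q\<close>
    as a combination of \<open>V\<close> and \<open>v\<close>. Hence \<open>Q\<close> is tangent and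
    needs no projection to be the covariant derivative of \<open>v\<close> along
    \<open>V\<close>.\<close>
  have Q: "Q x = inverse (\<mu> (\<phi> x)) *\<^sub>R (V (\<phi> x) - (V (\<phi> x) \<bullet> v (\<phi> x)) *\<^sub>R v (\<phi> x))"
    if x: "x \<in> U" for x
    using \<mu>[OF x] by (simp add: Q_def flip: shape[OF x])
  have QT: "Q x \<in> tangent_space A (\<phi> x)" if x: "x \<in> U" for x
  proof -
    have "V (\<phi> x) \<in> tangent_space A (\<phi> x)" "v (\<phi> x) \<in> tangent_space A (\<phi> x)"
      using T[OF x] va[OF x] Vw[OF x] by auto
    then show ?thesis unfolding Q[OF x] using sub[OF x]
      by (intro subspace_scale subspace_diff)
  qed
  have cov_Vv: "cov_deriv A V v (\<phi> x) = Q x" if x: "x \<in> U" for x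
    unfolding cov_deriv_def Vw[OF x] md[OF x v'[OF x]] Q_def[symmetric]
    by (rule tangential_part_unique[OF sub[OF x] QT[OF x]]) simp

  \<comment> \<open>The fields differentiated in the chart, and their Lie bracket\<close>
  obtain a' where a': "(a has_derivative a') (at u)" using a by (auto simp: differentiable_def)
  obtain w' where w': "(w has_derivative w') (at u)" using w by (auto simp: differentiable_def)
  obtain F' where F': "\<forall>\<^sub>F x in nhds u. (\<phi> has_derivative blinfun_apply (F' x)) (at x)"
    "F' differentiable (at u)"
    using chart_twice_differentiable[OF A U] unfolding twice_differentiable_at_def by blast
  obtain F'' where F'': "(F' has_derivative F'') (at u)" using F'(2) by (auto simp: differentiable_def)
  have DF: "\<forall>\<^sub>F x in nhds u. D x = blinfun_apply (F' x)"
    unfolding D_def using F'(1) by eventually_elim (rule frechet_derivative_at[symmetric])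
  have DFu: "blinfun_apply (F' u) = D u" using eventually_nhds_x_imp_x[OF DF] by simp
  have field: "((\<lambda>x. X (\<phi> x)) has_derivative (\<lambda>h. D u (b' h) + F'' h (b u))) (at u)"
    if X: "\<And>x. x \<in> U \<Longrightarrow> X (\<phi> x) = D x (b x)" and b: "(b has_derivative b') (at u)" for X b b'
  proof -
    have "((\<lambda>x. blinfun_apply (F' x) (b x)) has_derivative (\<lambda>h. D u (b' h) + F'' h (b u))) (at u)"
      using bounded_bilinear.FDERIV[OF bounded_bilinear_blinfun_apply F'' b] by (simp add: DFu)
    moreover have "\<forall>\<^sub>F x in nhds u. blinfun_apply (F' x) (b x) = X (\<phi> x)"
      using DF evU[OF U(2)] by eventually_elim (simp add: X)
    ultimately show ?thesis by (rule has_derivative_cong_nhds)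
  qed
  define V' where "V' h = D u (w' h) + F'' h (w u)" for h
  have V': "((\<lambda>x. V (\<phi> x)) has_derivative V') (at u)"
    unfolding V'_def using field[of V, OF Vw w'] .
  have v'_eq: "v' u h = D u (a' h) + F'' h (a u)" for h
    using has_derivative_unique[OF v'[OF U(2)] field[of v, OF va a']] by meson
  \<comment> \<open>These are the coordinates of the Lie bracket of \<open>V\<close> and
    \<open>v\<close>. The terms with \<open>F''\<close> in \<open>Q u - V' (a u)\<close> cancel by
    symmetry of the second derivative.\<close>
  define c where "c = a' (w u) - w' (a u)"
  have Dc: "D u c = Q u - V' (a u)"
    using symmetric_second_derivative[OF F'(1) F'', of "w u" "a u"]
    by (simp add: c_def Q_def V'_def v'_eq linear_diff[OF linD[OF U(2)]])
  have lie: "lie_bracket A V v (\<phi> u) = D u c"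
    unfolding lie_bracket_def Dc Q_def va[OF U(2)] Vw[OF U(2)]
      md[OF U(2) V'] md[OF U(2) v'[OF U(2)]] ..

  \<comment> \<open>The derivative of \<open>Q\<close>\<close>
  define X \<xi> q m where "X = V (\<phi> u)" and "\<xi> = v (\<phi> u)" and "q = Q u" and "m = \<mu> (\<phi> u)"
  have XT: "X \<in> tangent_space A (\<phi> u)" using T[OF U(2)] Vw[OF U(2)] by (simp add: X_def)
  define N' where "N' h = V' h - ((X \<bullet> \<xi>) *\<^sub>R v' u h + (X \<bullet> v' u h + V' h \<bullet> \<xi>) *\<^sub>R \<xi>)" for h
  have N': "((\<lambda>x. V (\<phi> x) - (V (\<phi> x) \<bullet> v (\<phi> x)) *\<^sub>R v (\<phi> x)) has_derivative N') (at u)"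
    unfolding N'_def X_def \<xi>_def
    by (intro has_derivative_diff has_derivative_scaleR has_derivative_inner V' v'[OF U(2)])
  \<comment> \<open>Since \<open>v'\<close> is not assumed differentiable, the derivative of
    \<open>Q\<close> is obtained from its expression through \<open>V\<close>, \<open>v\<close> and
    \<open>\<mu>\<close>.\<close>
  have "((\<lambda>x. inverse (\<mu> (\<phi> x)) *\<^sub>R (V (\<phi> x) - (V (\<phi> x) \<bullet> v (\<phi> x)) *\<^sub>R v (\<phi> x)))
      has_derivative (\<lambda>h. inverse m *\<^sub>R N' h + (- (inverse m * \<mu>' h * inverse m)) *\<^sub>R (X - (X \<bullet> \<xi>) *\<^sub>R \<xi>))) (at u)"
    unfolding X_def \<xi>_def m_def
    by (intro has_derivative_scaleR N' Deriv.has_derivative_inverse \<mu>' \<mu>[OF U(2)])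
  moreover have "\<forall>\<^sub>F x in nhds u. inverse (\<mu> (\<phi> x)) *\<^sub>R (V (\<phi> x) - (V (\<phi> x) \<bullet> v (\<phi> x)) *\<^sub>R v (\<phi> x)) = Q x"
    using evU[OF U(2)] by eventually_elim (simp add: Q)
  ultimately obtain Q' where Q': "(Q has_derivative Q') (at u)"
    using has_derivative_cong_nhds by blast
  \<comment> \<open>Differentiating \<open>\<mu> Q\<close> instead of the quotient gives a relation
    for \<open>Q'\<close> without inverses.\<close>
  have Q'_eq: "m *\<^sub>R Q' h + \<mu>' h *\<^sub>R q = N' h" for h
  proof -
    have "((\<lambda>x. \<mu> (\<phi> x) *\<^sub>R Q x) has_derivative (\<lambda>h. m *\<^sub>R Q' h + \<mu>' h *\<^sub>R q)) (at u)"
      unfolding m_def q_def by (rule has_derivative_scaleR[OF \<mu>' Q'])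
    moreover have "\<forall>\<^sub>F x in nhds u. \<mu> (\<phi> x) *\<^sub>R Q x = V (\<phi> x) - (V (\<phi> x) \<bullet> v (\<phi> x)) *\<^sub>R v (\<phi> x)"
      using evU[OF U(2)] by eventually_elim (simp add: Q_def shape)
    ultimately have "((\<lambda>x. V (\<phi> x) - (V (\<phi> x) \<bullet> v (\<phi> x)) *\<^sub>R v (\<phi> x)) has_derivative
        (\<lambda>h. m *\<^sub>R Q' h + \<mu>' h *\<^sub>R q)) (at u)"
      by (rule has_derivative_cong_nhds)
    from has_derivative_unique[OF this N'] show ?thesis by meson
  qed

  \<comment> \<open>The three terms of the curvature tensor\<close>
  have "cov_deriv A V (cov_deriv A v v) (\<phi> u) = 0"
  proof -
    \<comment> \<open>The inner covariant derivative vanishes at every point of the chart, so its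
      derivative vanishes as well.\<close>
    have "((\<lambda>x. cov_deriv A v v (\<phi> x)) has_derivative (\<lambda>h. 0)) (at u)"
    proof (rule has_derivative_cong_nhds[OF has_derivative_const])
      show "\<forall>\<^sub>F x in nhds u. 0 = cov_deriv A v v (\<phi> x)"
        using evU[OF U(2)] by eventually_elim (simp add: cov_vv)
    qed
    from md[OF U(2) this] have "mdiff A (cov_deriv A v v) (\<phi> u) (V (\<phi> u)) = 0"
      by (simp add: Vw[OF U(2)])
    then show ?thesis unfolding cov_deriv_def[of A V]
      using tangential_part_unique[OF sub[OF U(2)] subspace_0[OF sub[OF U(2)]]] by simp
  qed
  moreover have "cov_deriv A v (cov_deriv A V v) (\<phi> u) = tangential_part A (\<phi> u) (Q' (a u))"
  proof -
    have "((\<lambda>x. cov_deriv A V v (\<phi> x)) has_derivative Q') (at u)"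
    proof (rule has_derivative_cong_nhds[OF Q'])
      show "\<forall>\<^sub>F x in nhds u. Q x = cov_deriv A V v (\<phi> x)"
        using evU[OF U(2)] by eventually_elim (simp add: cov_Vv)
    qed
    from md[OF U(2) this] show ?thesis unfolding cov_deriv_def[of A v "cov_deriv A V v"]
      by (simp add: va[OF U(2)])
  qed
  moreover have "cov_deriv A (lie_bracket A V v) v (\<phi> u) = tangential_part A (\<phi> u) (v' u c)"
    unfolding cov_deriv_def lie md[OF U(2) v'[OF U(2)]] ..
  ultimately have R: "riemann A V v v (\<phi> u) \<bullet> X = - (Q' (a u) \<bullet> X) - v' u c \<bullet> X"
    unfolding riemann_def by (simp add: inner_diff_left inner_tangential_part[OF sub[OF U(2)] XT])

  \<comment> \<open>Numerator and denominator of the sectional curvature\<close>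
  have q\<xi>: "q \<bullet> \<xi> = 0" unfolding q_def Q_def \<xi>_def by (rule orth[OF U(2)])
  have \<xi>\<xi>: "\<xi> \<bullet> \<xi> = 1" using unit[OF U(2)] by (simp add: \<xi>_def dot_square_norm)
  have mq: "X = m *\<^sub>R q + (X \<bullet> \<xi>) *\<^sub>R \<xi>"
    using shape[OF U(2)] by (simp add: m_def q_def Q_def X_def \<xi>_def)
  have qa: "v' u (a u) \<bullet> q = 0"
    using QT[OF U(2)] geodesic[OF U(2)] T[OF U(2)] by (auto simp: q_def)
  \<comment> \<open>Differentiating \<open>Q \<bullet> v = 0\<close> along \<open>v\<close> leaves
    the extra term \<open>q \<bullet> v' u (a u)\<close>, which is zero because \<open>q\<close> is
    tangent and \<open>v\<close> is geodesic.\<close>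
  have Q'\<xi>: "Q' (a u) \<bullet> \<xi> = 0"
  proof -
    have "((\<lambda>x. Q x \<bullet> v (\<phi> x)) has_derivative (\<lambda>h. q \<bullet> v' u h + Q' h \<bullet> \<xi>)) (at u)"
      unfolding q_def \<xi>_def by (rule has_derivative_inner[OF Q' v'[OF U(2)]])
    moreover have "\<forall>\<^sub>F x in nhds u. Q x \<bullet> v (\<phi> x) = 0"
      using evU[OF U(2)] by eventually_elim (simp add: Q_def orth)
    ultimately have "((\<lambda>x. 0) has_derivative (\<lambda>h. q \<bullet> v' u h + Q' h \<bullet> \<xi>)) (at u)"
      by (rule has_derivative_cong_nhds)
    from has_derivative_unique[OF this has_derivative_const]
    have "q \<bullet> v' u (a u) + Q' (a u) \<bullet> \<xi> = 0" by meson
    then show ?thesis using qa by (simp add: inner_commute)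
  qed
  have "(m *\<^sub>R Q' (a u) + \<mu>' (a u) *\<^sub>R q) \<bullet> q = N' (a u) \<bullet> q" by (simp add: Q'_eq)
  also have "\<dots> = V' (a u) \<bullet> q"
    using qa q\<xi> by (simp add: N'_def inner_diff_right inner_add_right inner_commute)
  finally have 1: "m * (Q' (a u) \<bullet> q) = V' (a u) \<bullet> q - \<mu>' (a u) * (q \<bullet> q)"
    by (simp add: inner_add_left)
  have "Q' (a u) \<bullet> X = Q' (a u) \<bullet> (m *\<^sub>R q + (X \<bullet> \<xi>) *\<^sub>R \<xi>)" using mq by simp
  also have "\<dots> = m * (Q' (a u) \<bullet> q)" by (simp add: inner_add_right Q'\<xi>)
  finally have 2: "Q' (a u) \<bullet> X = V' (a u) \<bullet> q - \<mu>' (a u) * (q \<bullet> q)" using 1 by simp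
  \<comment> \<open>Closedness moves the derivative of \<open>v\<close> from the bracket direction
    to \<open>V\<close>, which turns the bracket term into the product of \<open>q\<close> with the
    bracket itself.\<close>
  have "v' u c \<bullet> X = q \<bullet> D u c"
    using closed[OF U(2), of c "w u"] by (simp add: X_def Vw[OF U(2)] q_def Q_def)
  then have 3: "v' u c \<bullet> X = q \<bullet> q - V' (a u) \<bullet> q"
    by (simp add: Dc q_def inner_diff_right inner_commute)
  \<comment> \<open>The two occurrences of \<open>V' (a u) \<bullet> q\<close> have opposite signs
    and cancel; the bracket term contributes the \<open>- 1\<close>.\<close>
  have num: "riemann A V v v (\<phi> u) \<bullet> X = (\<mu>' (a u) - 1) * (q \<bullet> q)"
    unfolding R 2 3 by (simp add: algebra_simps)
  \<comment> \<open>By \<open>mq\<close> the vector \<open>X\<close> is an orthogonal sum of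
    multiples of \<open>q\<close> and the unit vector \<open>\<xi>\<close>, so subtracting the
    square of its \<open>\<xi>\<close>-component leaves the part along \<open>q\<close>.\<close>
  have "X \<bullet> X = (m *\<^sub>R q + (X \<bullet> \<xi>) *\<^sub>R \<xi>) \<bullet> (m *\<^sub>R q + (X \<bullet> \<xi>) *\<^sub>R \<xi>)" using mq by simp
  also have "\<dots> = m\<^sup>2 * (q \<bullet> q) + (X \<bullet> \<xi>)\<^sup>2"
    using q\<xi> \<xi>\<xi> by (simp add: inner_add_left inner_add_right inner_commute power2_eq_square)
  finally have den: "(norm X)\<^sup>2 * (norm \<xi>)\<^sup>2 - (X \<bullet> \<xi>)\<^sup>2 = m\<^sup>2 * (q \<bullet> q)"
    using \<xi>\<xi> by (simp add: power2_norm_eq_inner)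
  have "mdiff A \<mu> (\<phi> u) \<xi> = \<mu>' (a u)"
    unfolding \<xi>_def va[OF U(2)] D_def by (rule mdiff_chart[OF A U \<mu>'])
  moreover have "q \<bullet> q \<noteq> 0" using nz by (simp add: q_def Q_def)
  moreover have "m \<noteq> 0" using \<mu>[OF U(2)] by (simp add: m_def)
  ultimately show ?thesis
    using num den unfolding sectional_curvature_def X_def \<xi>_def m_def by simp
qed

section \<open>Twice differentiable maps between submanifolds\<close>

text \<open>The pointwise counterpart of \<open>C2_map\<close>: it asks for a local expression near
  each point. In this form composites of the line maps and their inverses need no bookkeeping of
  domains.\<close>

definition twice_differentiable_map :: "('m::euclidean_space, 'a) atlas
    \<Rightarrow> ('k::euclidean_space, 'b) atlas \<Rightarrow> ('a \<Rightarrow> 'b) \<Rightarrow> bool" where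
  "twice_differentiable_map A B f \<longleftrightarrow>
     (\<forall>U \<phi> u W \<psi> s. (U, \<phi>) \<in> A \<longrightarrow> u \<in> U \<longrightarrow> (W, \<psi>) \<in> B \<longrightarrow> s \<in> W \<longrightarrow> f (\<phi> u) = \<psi> s \<longrightarrow>
        (\<exists>k. twice_differentiable_at k u \<and> k u = s \<and>
             (\<forall>\<^sub>F x in nhds u. x \<in> U \<and> k x \<in> W \<and> f (\<phi> x) = \<psi> (k x))))"

lemma twice_differentiable_mapD:
  assumes "twice_differentiable_map A B f" "(U, \<phi>) \<in> A" "u \<in> U" "(W, \<psi>) \<in> B" "s \<in> W" "f (\<phi> u) = \<psi> s"
  obtains k where "twice_differentiable_at k u" "k u = s"
    "\<forall>\<^sub>F x in nhds u. x \<in> U \<and> k x \<in> W \<and> f (\<phi> x) = \<psi> (k x)"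
  using assms unfolding twice_differentiable_map_def by blast

lemma C2_map_imp_twice_differentiable_map:
  assumes B: "immersed_submanifold T B" and f: "C2_map A B f"
  shows "twice_differentiable_map A B f"
  unfolding twice_differentiable_map_def
proof (intro allI impI)
  fix U \<phi> u W \<psi> s
  assume *: "(U, \<phi>) \<in> A" "u \<in> U" "(W, \<psi>) \<in> B" "s \<in> W" "f (\<phi> u) = \<psi> s"
  show "\<exists>k. twice_differentiable_at k u \<and> k u = s \<and>
      (\<forall>\<^sub>F x in nhds u. x \<in> U \<and> k x \<in> W \<and> f (\<phi> x) = \<psi> (k x))"
    by (rule C2_map_lift[OF f *(1-4) chart_inj_on[OF B *(3)] *(5)]) blast
qed

text \<open>A chart of the intermediate manifold around \<open>f (\<phi> u)\<close> is inserted, and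
  the two local expressions are composed.\<close>

lemma twice_differentiable_map_compose:
  assumes A: "immersed_submanifold S A" and B: "immersed_submanifold T B"
    and f: "twice_differentiable_map A B f" and fT: "f ` S \<subseteq> T" and g: "twice_differentiable_map B C g"
  shows "twice_differentiable_map A C (g \<circ> f)"
  unfolding twice_differentiable_map_def
proof (intro allI impI)
  fix U \<phi> u W \<psi> s
  assume U: "(U, \<phi>) \<in> A" "u \<in> U" and W: "(W, \<psi>) \<in> C" "s \<in> W" and s: "(g \<circ> f) (\<phi> u) = \<psi> s"
  have "f (\<phi> u) \<in> T" using chart_mem[OF A U] fT by blast
  then obtain Z \<gamma> z where Z: "(Z, \<gamma>) \<in> B" "z \<in> Z" "\<gamma> z = f (\<phi> u)"
    using chart_exists[OF B] by blast
  obtain i where i: "twice_differentiable_at i u" "i u = z"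
    "\<forall>\<^sub>F x in nhds u. x \<in> U \<and> i x \<in> Z \<and> f (\<phi> x) = \<gamma> (i x)"
    using twice_differentiable_mapD[OF f U Z(1,2) Z(3)[symmetric]] .
  have "g (\<gamma> z) = \<psi> s" using s Z(3) by simp
  then obtain j where j: "twice_differentiable_at j z" "j z = s"
    "\<forall>\<^sub>F x in nhds z. x \<in> Z \<and> j x \<in> W \<and> g (\<gamma> x) = \<psi> (j x)"
    using twice_differentiable_mapD[OF g Z(1,2) W] by blast
  have "isCont i u"
    using twice_differentiable_at_imp_differentiable[OF i(1)]
    by (rule differentiable_imp_continuous_within)
  from eventually_nhds_compose[OF this j(3)[folded i(2)]] i(3)
  have "\<forall>\<^sub>F x in nhds u. x \<in> U \<and> j (i x) \<in> W \<and> (g \<circ> f) (\<phi> x) = \<psi> (j (i x))"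
    by eventually_elim simp
  moreover have "twice_differentiable_at (\<lambda>x. j (i x)) u"
    using twice_differentiable_at_compose[OF i(1)] j(1) i(2) by blast
  moreover have "j (i u) = s" using i(2) j(2) by simp
  ultimately show "\<exists>k. twice_differentiable_at k u \<and> k u = s \<and>
      (\<forall>\<^sub>F x in nhds u. x \<in> U \<and> k x \<in> W \<and> (g \<circ> f) (\<phi> x) = \<psi> (k x))"
    by (intro exI[of _ "\<lambda>x. j (i x)"]) simp
qed

text \<open>The local expressions \<open>k\<close> of \<open>f\<close> and \<open>j\<close> of
  \<open>g\<close> are mutually inverse near the points, so \<open>k'\<close> and \<open>j'\<close>
  are inverse linear maps. It serves twice: for the correspondence between the two submanifolds and
  for \<open>Phi v1\<close>.\<close>

lemma inverse_maps_derivative: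
  assumes A: "immersed_submanifold S A" and B: "immersed_submanifold T B"
    and f: "twice_differentiable_map A B f" and g: "twice_differentiable_map B A g"
    and fT: "\<And>p. p \<in> S \<Longrightarrow> f p \<in> T" and gf: "\<And>p. p \<in> S \<Longrightarrow> g (f p) = p"
    and fg: "\<And>q. q \<in> T \<Longrightarrow> f (g q) = q"
    and U: "(U, \<phi>) \<in> A" "u \<in> U"
  obtains f' where "((\<lambda>x. f (\<phi> x)) has_derivative f') (at u)"
    "twice_differentiable_at (\<lambda>x. f (\<phi> x)) u" "inj f'" "range f' = tangent_space B (f (\<phi> u))"
    "\<And>w. mdiff B g (f (\<phi> u)) (f' w) = frechet_derivative \<phi> (at u) w"
proof -
  have uS: "\<phi> u \<in> S" by (rule chart_mem[OF A U])
  obtain W \<psi> s where W: "(W, \<psi>) \<in> B" "s \<in> W" "\<psi> s = f (\<phi> u)"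
    using chart_exists[OF B fT[OF uS]] .
  obtain k where k: "twice_differentiable_at k u" "k u = s"
    "\<forall>\<^sub>F x in nhds u. x \<in> U \<and> k x \<in> W \<and> f (\<phi> x) = \<psi> (k x)"
    using twice_differentiable_mapD[OF f U W(1,2) W(3)[symmetric]] .
  have "g (\<psi> s) = \<phi> u" using W(3) gf[OF uS] by simp
  then obtain j where j: "twice_differentiable_at j s" "j s = u"
    "\<forall>\<^sub>F y in nhds s. y \<in> W \<and> j y \<in> U \<and> g (\<psi> y) = \<phi> (j y)"
    using twice_differentiable_mapD[OF g W(1,2) U] by blast
  obtain k' where k': "(k has_derivative k') (at u)"
    using twice_differentiable_at_imp_differentiable[OF k(1)] by (auto simp: differentiable_def)
  obtain j' where j': "(j has_derivative j') (at s)"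
    using twice_differentiable_at_imp_differentiable[OF j(1)] by (auto simp: differentiable_def)
  have jk: "j' (k' w) = w" for w
  proof -
    from eventually_nhds_compose[OF has_derivative_continuous[OF k'] j(3)[folded k(2)]] k(3)
    have "\<forall>\<^sub>F x in nhds u. j (k x) = x"
    proof eventually_elim
      case (elim x)
      have "\<phi> (j (k x)) = g (f (\<phi> x))" using elim by simp
      also have "\<dots> = \<phi> x" using gf[OF chart_mem[OF A U(1), of x]] elim by blast
      finally show ?case using elim inj_onD[OF chart_inj_on[OF A U(1)]] by blast
    qed
    moreover have "((\<lambda>x. j (k x)) has_derivative (\<lambda>h. j' (k' h))) (at u)"
      using has_derivative_compose[OF k', of j j'] j' k(2) by simp
    ultimately have "((\<lambda>x. x) has_derivative (\<lambda>h. j' (k' h))) (at u)"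
      by (rule has_derivative_cong_nhds[rotated])
    from has_derivative_unique[OF this has_derivative_ident] show ?thesis by meson
  qed
  have kj: "k' (j' z) = z" for z
  proof -
    from eventually_nhds_compose[OF has_derivative_continuous[OF j'] k(3)[folded j(2)]] j(3)
    have "\<forall>\<^sub>F y in nhds s. k (j y) = y"
    proof eventually_elim
      case (elim y)
      have "\<psi> (k (j y)) = f (g (\<psi> y))" using elim by simp
      also have "\<dots> = \<psi> y" using fg[OF chart_mem[OF B W(1), of y]] elim by blast
      finally show ?case using elim inj_onD[OF chart_inj_on[OF B W(1)]] by blast
    qed
    moreover have "((\<lambda>y. k (j y)) has_derivative (\<lambda>h. k' (j' h))) (at s)"
      using has_derivative_compose[OF j', of k k'] k' j(2) by simp
    ultimately have "((\<lambda>y. y) has_derivative (\<lambda>h. k' (j' h))) (at s)"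
      by (rule has_derivative_cong_nhds[rotated])
    from has_derivative_unique[OF this has_derivative_ident] show ?thesis by meson
  qed
  define E where "E = frechet_derivative \<psi> (at s)"
  have E: "(\<psi> has_derivative E) (at s)" unfolding E_def by (rule chart_has_derivative[OF B W(1,2)])
  have eq: "\<forall>\<^sub>F x in nhds u. \<psi> (k x) = f (\<phi> x)" using k(3) by eventually_elim simp
  show ?thesis
  proof
    have "((\<lambda>x. \<psi> (k x)) has_derivative (\<lambda>w. E (k' w))) (at u)"
      using has_derivative_compose[OF k', of \<psi> E] E k(2) by simp
    then show "((\<lambda>x. f (\<phi> x)) has_derivative (\<lambda>w. E (k' w))) (at u)"
      using eq by (rule has_derivative_cong_nhds)
    show "twice_differentiable_at (\<lambda>x. f (\<phi> x)) u"
    proof (rule twice_differentiable_at_cong[OF _ eq])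
      show "twice_differentiable_at (\<lambda>x. \<psi> (k x)) u"
        using twice_differentiable_at_compose[OF k(1)] chart_twice_differentiable[OF B W(1,2)] k(2)
        by blast
    qed
    show "inj (\<lambda>w. E (k' w))"
      using chart_immersion[OF B W(1,2)] unfolding E_def[symmetric] by (metis injI injD jk)
    have "surj k'" using kj by (metis surjI)
    then have "range (\<lambda>w. E (k' w)) = range E" by (metis image_image)
    then show "range (\<lambda>w. E (k' w)) = tangent_space B (f (\<phi> u))"
      using tangent_space_chart[OF B W(1,2)] W(3) by (simp add: E_def)
    fix w
    have "((\<lambda>y. \<phi> (j y)) has_derivative (\<lambda>h. frechet_derivative \<phi> (at u) (j' h))) (at s)"
      using has_derivative_compose[OF j', of \<phi>] chart_has_derivative[OF A U] j(2) by simp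
    moreover have "\<forall>\<^sub>F y in nhds s. \<phi> (j y) = g (\<psi> y)" using j(3) by eventually_elim simp
    ultimately have "((\<lambda>y. g (\<psi> y)) has_derivative (\<lambda>h. frechet_derivative \<phi> (at u) (j' h))) (at s)"
      by (rule has_derivative_cong_nhds)
    from mdiff_chart[OF B W(1,2) this] show "mdiff B g (f (\<phi> u)) (E (k' w)) = frechet_derivative \<phi> (at u) w"
      by (simp add: E_def W(3) jk)
  qed
qed

section \<open>The symplectic form on oriented lines\<close>

text \<open>The tautological form is linear in the base point, so its exterior derivative has
  constant coefficients: the standard symplectic form on pairs.\<close>

lemma Omega_eq: "Omega q X Y = fst X \<bullet> snd Y - fst Y \<bullet> snd X"
proof -
  have "frechet_derivative (\<lambda>z. fst Y \<bullet> snd z) (at q) = (\<lambda>h. fst Y \<bullet> snd h)" for Y :: "'a \<times> 'a"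
    by (rule frechet_derivative_at[symmetric]) (auto intro!: derivative_eq_intros)
  then show ?thesis by (simp add: Omega_def ext_deriv_def theta_def)
qed

text \<open>Two points on the same oriented line share its direction and have the same component
  orthogonal to it, so they differ by a multiple of the direction. The coefficient is the signed
  distance.\<close>

lemma Phi_eqD:
  assumes "Phi v p = Phi w q" "norm (v p) = 1"
  shows "v p = w q" and "q = p - ((p - q) \<bullet> v p) *\<^sub>R v p"
proof -
  show "v p = w q" using assms(1) by (simp add: Phi_def)
  then have "p - (v p \<bullet> p) *\<^sub>R v p = q - (v p \<bullet> q) *\<^sub>R v p" using assms(1) by (simp add: Phi_def)
  then show "q = p - ((p - q) \<bullet> v p) *\<^sub>R v p" 
    by (simp add: inner_diff_left scaleR_diff_left inner_commute algebra_simps)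
qed

lemma Phi_has_derivative:
  assumes \<phi>: "(\<phi> has_derivative D) (at u)" and v: "((\<lambda>x. v (\<phi> x)) has_derivative v') (at u)"
  shows "((\<lambda>x. Phi v (\<phi> x)) has_derivative (\<lambda>h. (v' h,
    D h - ((v (\<phi> u) \<bullet> \<phi> u) *\<^sub>R v' h + (v (\<phi> u) \<bullet> D h + v' h \<bullet> \<phi> u) *\<^sub>R v (\<phi> u))))) (at u)"
  unfolding Phi_def
  by (intro has_derivative_Pair has_derivative_diff has_derivative_scaleR has_derivative_inner assms)

section \<open>The curvature formula\<close>

theorem theorem2:
  fixes S1 S2 :: "'a::euclidean_space set"
    and A1 :: "('m::euclidean_space, 'a) atlas"
    and A2 :: "('k::euclidean_space, 'a) atlas"
    and \<Gamma> :: "('a \<times> 'a) set"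
    and G :: "('l::euclidean_space, 'a \<times> 'a) atlas"
    and v1 v2 :: "'a \<Rightarrow> 'a"
  assumes "immersed_submanifold S1 A1" and "immersed_submanifold S2 A2"
    and "unit_tangent_field S1 A1 v1" and "unit_tangent_field S2 A2 v2"
    and "Phi v1 ` S1 = \<Gamma>" and "Phi v2 ` S2 = \<Gamma>"
    and "\<Gamma> \<subseteq> TSphere" and "immersed_submanifold \<Gamma> G"
    and "diffeomorphism S1 A1 \<Gamma> G (Phi v1)"
    and "diffeomorphism S2 A2 \<Gamma> G (Phi v2)"
    and "isotropic \<Gamma> G"
    and "\<forall>p\<in>S1. signed_distance S2 v1 v2 p \<noteq> 0"
  shows "\<forall>p\<in>S1. sectional_curvature A1 (transported_field S1 S2 A2 v1 v2) v1 p =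
           (mdiff A1 (signed_distance S2 v1 v2) p (v1 p) - 1) / (signed_distance S2 v1 v2 p)\<^sup>2"
proof
  fix p assume p: "p \<in> S1"
  note M1 = assms(1) and M2 = assms(2) and MG = assms(8)
  \<comment> \<open>\<open>h\<close> sends a point of \<open>S1\<close> to the point of
    \<open>S2\<close> carrying the same oriented line, and \<open>g\<close> is its inverse.\<close>
  define h g where "h = inv_into S2 (Phi v2) \<circ> Phi v1" and "g = inv_into S1 (Phi v1) \<circ> Phi v2"
  define V \<mu> where "V = transported_field S1 S2 A2 v1 v2" and "\<mu> = signed_distance S2 v1 v2"
  have bij: "bij_betw (Phi v1) S1 \<Gamma>" "bij_betw (Phi v2) S2 \<Gamma>"
    and C2: "C2_map A1 G (Phi v1)" "C2_map G A1 (inv_into S1 (Phi v1))"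
      "C2_map A2 G (Phi v2)" "C2_map G A2 (inv_into S2 (Phi v2))"
    using assms(9,10) by (simp_all add: diffeomorphism_def)
  note inv = bij_betwE[OF bij(1)] bij_betwE[OF bij(2)] bij_betwE[OF bij_betw_inv_into[OF bij(1)]]
    bij_betwE[OF bij_betw_inv_into[OF bij(2)]]
    bij_betw_inv_into_left[OF bij(1)] bij_betw_inv_into_left[OF bij(2)]
    bij_betw_inv_into_right[OF bij(1)] bij_betw_inv_into_right[OF bij(2)]
  have hS: "h p \<in> S2" "g (h p) = p" "Phi v2 (h p) = Phi v1 p" if "p \<in> S1" for p
    using inv that by (simp_all add: h_def g_def)
  have gS: "g q \<in> S1" "h (g q) = q" if "q \<in> S2" for q
    using inv that by (simp_all add: h_def g_def)
  have "twice_differentiable_map A1 G (Phi v1)" "twice_differentiable_map G A1 (inv_into S1 (Phi v1))"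
    "twice_differentiable_map A2 G (Phi v2)" "twice_differentiable_map G A2 (inv_into S2 (Phi v2))"
    using C2 C2_map_imp_twice_differentiable_map M1 M2 MG by blast+
  note tdm = this
  have h: "twice_differentiable_map A1 A2 h" unfolding h_def
    by (rule twice_differentiable_map_compose[OF M1 MG tdm(1) _ tdm(4)]) (simp add: assms(5))
  have g: "twice_differentiable_map A2 A1 g" unfolding g_def
    by (rule twice_differentiable_map_compose[OF M2 MG tdm(3) _ tdm(2)]) (simp add: assms(6))

  \<comment> \<open>The first submanifold and its unit field in a chart\<close>
  obtain U \<phi> u where U: "(U, \<phi>) \<in> A1" "u \<in> U" "\<phi> u = p" using chart_exists[OF M1 p] .
  define D where "D x = frechet_derivative \<phi> (at x)" for x
  have S: "\<phi> x \<in> S1" if "x \<in> U" for x using chart_mem[OF M1 U(1) that] .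
  have D: "(\<phi> has_derivative D x) (at x)" if "x \<in> U" for x
    unfolding D_def by (rule chart_has_derivative[OF M1 U(1) that])
  have unit: "norm (v1 (\<phi> x)) = 1" if "x \<in> U" for x
    using assms(3) S[OF that] by (simp add: unit_tangent_field_def)
  have vtd: "twice_differentiable_at (\<lambda>x. v1 (\<phi> x)) x" if "x \<in> U" for x
  proof (rule C2_on_imp_twice_differentiable_at[OF _ chart_open[OF M1 U(1)] that])
    show "C2_on U (\<lambda>x. v1 (\<phi> x))"
      using assms(3) U(1) unfolding unit_tangent_field_def by auto
  qed
  define v' where "v' x = frechet_derivative (\<lambda>x. v1 (\<phi> x)) (at x)" for x
  have v': "((\<lambda>x. v1 (\<phi> x)) has_derivative v' x) (at x)" if "x \<in> U" for x
    unfolding v'_def using twice_differentiable_at_imp_differentiable[OF vtd[OF that]]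
    by (simp add: frechet_derivative_works)
  have evU: "\<forall>\<^sub>F z in nhds x. z \<in> U" if "x \<in> U" for x
    using chart_open[OF M1 U(1)] that by (rule eventually_nhds_in_open)
  have orth: "v' x b \<bullet> v1 (\<phi> x) = 0" if x: "x \<in> U" for x b
  proof (rule unit_norm_has_derivative[OF v'[OF x]])
    show "\<forall>\<^sub>F x in nhds x. norm (v1 (\<phi> x)) = 1"
      using evU[OF x] by eventually_elim (rule unit)
  qed
  \<comment> \<open>The coordinates are chosen point by point; their differentiability is recovered
    later from the linear system that they solve.\<close>
  have "\<exists>a. \<forall>x\<in>U. v1 (\<phi> x) = D x (a x)"
  proof (rule bchoice, rule ballI)
    fix x assume x: "x \<in> U"
    have "v1 (\<phi> x) \<in> tangent_space A1 (\<phi> x)"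
      using assms(3) S[OF x] by (simp add: unit_tangent_field_def)
    then show "\<exists>a. v1 (\<phi> x) = D x a"
      unfolding D_def tangent_space_chart[OF M1 U(1) x] by blast
  qed
  then obtain a where a: "\<And>x. x \<in> U \<Longrightarrow> v1 (\<phi> x) = D x (a x)" by blast

  \<comment> \<open>The corresponding point of \<open>S2\<close> and the transported field\<close>
  define y' where "y' x = frechet_derivative (\<lambda>x. h (\<phi> x)) (at x)" for x
  have y': "((\<lambda>x. h (\<phi> x)) has_derivative y' x) (at x)" "twice_differentiable_at (\<lambda>x. h (\<phi> x)) x"
    "inj (y' x)" "\<exists>w. V (\<phi> x) = D x w \<and> y' x w = v1 (\<phi> x)" if x: "x \<in> U" for x
  proof -
    obtain f' where f': "((\<lambda>x. h (\<phi> x)) has_derivative f') (at x)"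
      "twice_differentiable_at (\<lambda>x. h (\<phi> x)) x" "inj f'" "range f' = tangent_space A2 (h (\<phi> x))"
      "\<And>w. mdiff A2 g (h (\<phi> x)) (f' w) = frechet_derivative \<phi> (at x) w"
      using inverse_maps_derivative[OF M1 M2 h g hS(1,2) gS(2) U(1) x] by blast
    have [simp]: "f' = y' x" unfolding y'_def by (rule frechet_derivative_at[OF f'(1)])
    show "((\<lambda>x. h (\<phi> x)) has_derivative y' x) (at x)" "twice_differentiable_at (\<lambda>x. h (\<phi> x)) x"
      "inj (y' x)" using f' by simp_all
    \<comment> \<open>As \<open>v2\<close> is tangent to \<open>S2\<close>, it has a preimage
      \<open>w\<close> under the differential of \<open>h \<circ> \<phi>\<close>. The differential
      of \<open>g\<close> takes \<open>v2\<close> back to \<open>D x w\<close>, which is the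
      transported field.\<close>
    have "v2 (h (\<phi> x)) \<in> range f'"
      using assms(4) hS(1)[OF S[OF x]] f'(4) by (simp add: unit_tangent_field_def)
    then obtain w where w: "v2 (h (\<phi> x)) = f' w" by blast
    have "v1 (\<phi> x) = v2 (h (\<phi> x))"
      using Phi_eqD(1)[OF hS(3)[OF S[OF x], symmetric] unit[OF x]] .
    moreover have "V (\<phi> x) = D x w"
      using f'(5)[of w] w unfolding V_def transported_field_def D_def Let_def
      by (simp add: h_def[symmetric] g_def[symmetric] flip: w)
    ultimately show "\<exists>w. V (\<phi> x) = D x w \<and> y' x w = v1 (\<phi> x)" using w by auto
  qed
  have "\<exists>w. \<forall>x\<in>U. V (\<phi> x) = D x (w x) \<and> y' x (w x) = v1 (\<phi> x)"
    by (rule bchoice) (use y'(4) in blast)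
  then obtain w where w: "\<And>x. x \<in> U \<Longrightarrow> V (\<phi> x) = D x (w x)" "\<And>x. x \<in> U \<Longrightarrow> y' x (w x) = v1 (\<phi> x)"
    by blast
  have y: "h (\<phi> x) = \<phi> x - \<mu> (\<phi> x) *\<^sub>R v1 (\<phi> x)" if x: "x \<in> U" for x
    using Phi_eqD(2)[OF hS(3)[OF S[OF x], symmetric] unit[OF x]]
    by (simp add: \<mu>_def signed_distance_def h_def)

  \<comment> \<open>The derivative of the signed distance and the relation between \<open>V\<close>
    and the derivative of \<open>v1\<close>\<close>
  define \<mu>' where "\<mu>' x b = (\<phi> x - h (\<phi> x)) \<bullet> v' x b + (D x b - y' x b) \<bullet> v1 (\<phi> x)" for x b
  have \<mu>': "((\<lambda>x. \<mu> (\<phi> x)) has_derivative \<mu>' x) (at x)" if x: "x \<in> U" for x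
    unfolding \<mu>'_def \<mu>_def signed_distance_def h_def[symmetric]
    by (intro has_derivative_inner has_derivative_diff D y' v' x)
  \<comment> \<open>The identity \<open>h = \<phi> - \<mu> v1\<close> is differentiated in the
    direction \<open>w\<close>, where the left side gives \<open>v1\<close>. Pairing with
    \<open>v1\<close> identifies the coefficient \<open>1 + \<mu>' x (w x)\<close> as
    \<open>V \<bullet> v1\<close>.\<close>
  have shape: "\<mu> (\<phi> x) *\<^sub>R v' x (w x) = V (\<phi> x) - (V (\<phi> x) \<bullet> v1 (\<phi> x)) *\<^sub>R v1 (\<phi> x)" if x: "x \<in> U" for x
  proof -
    have "((\<lambda>x. \<phi> x - \<mu> (\<phi> x) *\<^sub>R v1 (\<phi> x)) has_derivative
        (\<lambda>b. D x b - (\<mu> (\<phi> x) *\<^sub>R v' x b + \<mu>' x b *\<^sub>R v1 (\<phi> x)))) (at x)"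
      by (intro has_derivative_diff has_derivative_scaleR D v' \<mu>' x)
    moreover have "\<forall>\<^sub>F x in nhds x. \<phi> x - \<mu> (\<phi> x) *\<^sub>R v1 (\<phi> x) = h (\<phi> x)"
      using evU[OF x] by eventually_elim (simp add: y)
    ultimately have "((\<lambda>x. h (\<phi> x)) has_derivative
        (\<lambda>b. D x b - (\<mu> (\<phi> x) *\<^sub>R v' x b + \<mu>' x b *\<^sub>R v1 (\<phi> x)))) (at x)"
      by (rule has_derivative_cong_nhds)
    from has_derivative_unique[OF y'(1)[OF x] this]
    have "y' x (w x) = D x (w x) - (\<mu> (\<phi> x) *\<^sub>R v' x (w x) + \<mu>' x (w x) *\<^sub>R v1 (\<phi> x))"
      by meson
    then have 1: "\<mu> (\<phi> x) *\<^sub>R v' x (w x) = V (\<phi> x) - (1 + \<mu>' x (w x)) *\<^sub>R v1 (\<phi> x)"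
      by (simp add: w[OF x] algebra_simps)
    have "\<mu> (\<phi> x) *\<^sub>R v' x (w x) \<bullet> v1 (\<phi> x) = 0" using orth[OF x] by simp
    then have "V (\<phi> x) \<bullet> v1 (\<phi> x) = 1 + \<mu>' x (w x)"
      unfolding 1 using unit[OF x] by (simp add: inner_diff_left dot_square_norm)
    then show ?thesis using 1 by simp
  qed

  \<comment> \<open>Consequences of isotropy and of the immersion into the space of lines\<close>
  define P' where "P' x b = (v' x b, D x b - ((v1 (\<phi> x) \<bullet> \<phi> x) *\<^sub>R v' x b +
    (v1 (\<phi> x) \<bullet> D x b + v' x b \<bullet> \<phi> x) *\<^sub>R v1 (\<phi> x)))" for x b
  have P': "inj (P' x)" "range (P' x) = tangent_space G (Phi v1 (\<phi> x))" if x: "x \<in> U" for x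
  proof -
    obtain f' where f': "((\<lambda>x. Phi v1 (\<phi> x)) has_derivative f') (at x)" "inj f'"
      "range f' = tangent_space G (Phi v1 (\<phi> x))"
      using inverse_maps_derivative[OF M1 MG tdm(1,2) _ _ _ U(1) x] inv by (metis (no_types, lifting))
    have "((\<lambda>x. Phi v1 (\<phi> x)) has_derivative P' x) (at x)"
      unfolding P'_def by (rule Phi_has_derivative[OF D[OF x] v'[OF x]])
    from has_derivative_unique[OF f'(1) this]
    show "inj (P' x)" "range (P' x) = tangent_space G (Phi v1 (\<phi> x))" using f' by simp_all
  qed
  \<comment> \<open>In the symplectic form the terms with two factors \<open>v'\<close> cancel by
    symmetry, and those with \<open>v1\<close> vanish by \<open>orth\<close>. What remains is the
    antisymmetric part of \<open>v' x b \<bullet> D x c\<close>.\<close>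
  have closed: "v' x b \<bullet> D x c = v' x c \<bullet> D x b" if x: "x \<in> U" for x b c
  proof -
    have "Phi v1 (\<phi> x) \<in> \<Gamma>" using S[OF x] assms(5) by blast
    moreover have "P' x b \<in> tangent_space G (Phi v1 (\<phi> x))" "P' x c \<in> tangent_space G (Phi v1 (\<phi> x))"
      using P'(2)[OF x] by auto
    ultimately have "Omega (Phi v1 (\<phi> x)) (P' x b) (P' x c) = 0"
      using assms(11) unfolding isotropic_def by blast
    then show ?thesis
      using orth[OF x] by (simp add: Omega_eq P'_def inner_diff_right inner_add_right inner_commute)
  qed
  \<comment> \<open>If \<open>V\<close> were parallel to \<open>v1\<close>, then \<open>Phi v1\<close> would not be an immersion.\<close>
  have nz: "v' u (w u) \<noteq> 0"
  proof
    assume 0: "v' u (w u) = 0"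
    then have "D u (w u) = (D u (w u) \<bullet> v1 (\<phi> u)) *\<^sub>R v1 (\<phi> u)"
      using shape[OF U(2)] w(1)[OF U(2)] by simp
    then have "P' u (w u) = 0" by (simp add: P'_def 0 zero_prod_def inner_commute)
    moreover have "P' u 0 = 0"
      using linear_0[OF has_derivative_linear[OF D[OF U(2)]]] linear_0[OF has_derivative_linear[OF v'[OF U(2)]]]
      by (simp add: P'_def zero_prod_def)
    ultimately have "w u = 0" using injD[OF P'(1)[OF U(2)]] by metis
    \<comment> \<open>The vector \<open>w u\<close> was chosen so that the differential of
      \<open>h \<circ> \<phi>\<close> maps it to a unit vector, so it cannot be 0.\<close>
    then have "v1 (\<phi> u) = 0"
      using w(2)[OF U(2)] linear_0[OF has_derivative_linear[OF y'(1)[OF U(2)]]] by simp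
    then show False using unit[OF U(2)] by simp
  qed

  \<comment> \<open>Differentiability of the coordinate vectors, and conclusion\<close>
  have vd: "(\<lambda>x. v1 (\<phi> x)) differentiable (at u)"
    by (rule twice_differentiable_at_imp_differentiable[OF vtd[OF U(2)]])
  have ad: "a differentiable (at u)"
  proof (rule differentiable_solve_derivative[OF chart_twice_differentiable[OF M1 U(1,2)]
        chart_immersion[OF M1 U(1,2)] vd])
    show "\<forall>\<^sub>F x in nhds u. frechet_derivative \<phi> (at x) (a x) = v1 (\<phi> x)"
      using evU[OF U(2)] by eventually_elim (simp add: a D_def)
  qed
  \<comment> \<open>Differentiability of \<open>V\<close> is not yet available, so \<open>w\<close>
    is solved from the system given by the derivative of \<open>h \<circ> \<phi>\<close>, whose
    right-hand side \<open>v1\<close> is differentiable.\<close>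
  have wd: "w differentiable (at u)"
  proof (rule differentiable_solve_derivative[OF y'(2)[OF U(2)] y'(3)[OF U(2), unfolded y'_def] vd])
    show "\<forall>\<^sub>F x in nhds u. frechet_derivative (\<lambda>x. h (\<phi> x)) (at x) (w x) = v1 (\<phi> x)"
      using evU[OF U(2)] by eventually_elim (simp add: w(2) flip: y'_def)
  qed
  have \<mu>: "\<mu> (\<phi> x) \<noteq> 0" if "x \<in> U" for x using assms(12) S[OF that] by (simp add: \<mu>_def)
  have "sectional_curvature A1 V v1 (\<phi> u) =
      (mdiff A1 \<mu> (\<phi> u) (v1 (\<phi> u)) - 1) / (\<mu> (\<phi> u))\<^sup>2"
    by (rule sectional_curvature_closed_field[OF M1 U(1,2) unit a[unfolded D_def] w(1)[unfolded D_def]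
          v' ad wd closed[unfolded D_def] \<mu>'[OF U(2)] \<mu> shape nz])
  then show "sectional_curvature A1 (transported_field S1 S2 A2 v1 v2) v1 p =
      (mdiff A1 (signed_distance S2 v1 v2) p (v1 p) - 1) / (signed_distance S2 v1 v2 p)\<^sup>2"
    by (simp add: U(3) V_def \<mu>_def)
qed

end
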